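(* Fix $\epsilon\in(0,1)$, $\delta\in(0,\tfrac1e)$ and $B>0$. Let $A$ be an $(n\times d)$-matrix in which every row has $\ell_2$-norm at most $B$. Let $N$ be a matrix sampled from the $d$-dimensional Wishart distribution with $k$ degrees of freedom and scale matrix $B^2 I_{d\times d}$, i.e. $N\sim\mathcal W_d(B^2 I_{d\times d},k)$, where $k\ge\lfloor d+\tfrac{14}{\epsilon^2}\cdot 2\ln(4/\delta)\rfloor$. Then the algorithm outputting $X=A^{\top}A+N$ is $(\epsilon,\delta)$-differentially private.
   Context: The Wishart distribution $\mathcal W_d(V,m)$ (for a $d\times d$ positive definite $V$ and positive integer $m$) is the distribution of $\sum_{i=1}^m \mathbf g_i\mathbf g_i^{\top}$ where $\mathbf g_1,\dots,\mathbf g_m$ are i.i.d. samples from the multivariate Gaussian $\mathcal N(\mathbf 0_d,V)$. Two $(n\times d)$-matrices are neighbors if they differ in exactly one row. A randomized algorithm on $(n\times d)$-matrices with rows of $\ell_2$-norm at most $B$ is $(\epsilon,\delta)$-differentially private if for all neighboring such inputs $A,A'$ and every measurable set $S$ of outputs, $\Pr[\mathsf{ALG}(A)\in S]\le e^{\epsilon}\Pr[\mathsf{ALG}(A')\in S]+\delta$. *)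

theory Defs
  imports "HOL-Probability.Probability"
begin

text \<open>A d x d matrix is real^'d^'d; an (n x d)-matrix is real^'d^'n (row i is A $ i).\<close>

definition positive_definite :: "real^'d^'d \<Rightarrow> bool" where
  "positive_definite V \<longleftrightarrow> transpose V = V \<and> (\<forall>x. x \<noteq> 0 \<longrightarrow> x \<bullet> (V *v x) > 0)"

definition mvnormal_density :: "real^'d^'d \<Rightarrow> real^'d \<Rightarrow> real" where
  "mvnormal_density V x =
     exp (- (x \<bullet> (matrix_inv V *v x)) / 2) / sqrt ((2 * pi) ^ CARD('d) * det V)"

definition mvnormal :: "real^'d^'d \<Rightarrow> (real^'d) measure" where
  "mvnormal V = density lborel (\<lambda>x. ennreal (mvnormal_density V x))"

definition outer :: "real^'d \<Rightarrow> real^'d^'d" where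
  "outer g = (\<chi> i j. g $ i * g $ j)"

definition wishart :: "real^'d^'d \<Rightarrow> nat \<Rightarrow> (real^'d^'d) measure" where
  "wishart V m = distr (PiM {..<m} (\<lambda>_. mvnormal V)) borel (\<lambda>g. \<Sum>i<m. outer (g i))"

definition rows_bounded :: "real \<Rightarrow> real^'d^'n \<Rightarrow> bool" where
  "rows_bounded B A \<longleftrightarrow> (\<forall>i. norm (A $ i) \<le> B)"

definition neighbors :: "real^'d^'n \<Rightarrow> real^'d^'n \<Rightarrow> bool" where
  "neighbors A A' \<longleftrightarrow> card {i. A $ i \<noteq> A' $ i} = 1"

definition differentially_private ::
  "real \<Rightarrow> real \<Rightarrow> real \<Rightarrow> (real^'d^'n \<Rightarrow> 'b::topological_space measure) \<Rightarrow> bool" where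
  "differentially_private \<epsilon> \<delta> B ALG \<longleftrightarrow>
     (\<forall>A A'. rows_bounded B A \<and> rows_bounded B A' \<and> neighbors A A' \<longrightarrow>
        (\<forall>S \<in> sets borel. measure (ALG A) S \<le> exp \<epsilon> * measure (ALG A') S + \<delta>))"

end

theory Submission
  imports Defs
begin

text \<open>
  Passing from \<^term>\<open>A\<close> to a neighbor removes one rank-one term \<^term>\<open>outer a\<close> and adds another, so it
  suffices to compare the Wishart matrix \<^term>\<open>N\<close> with \<^term>\<open>N + outer a\<close>, in both directions, with
  privacy parameters \<open>\<epsilon> / 2\<close> and \<open>\<delta> / 4\<close>.

  Let \<open>e\<close> be the direction of \<open>a\<close> and split the Gaussian samples as \<open>g\<^sub>i = x\<^sub>i e + v\<^sub>i\<close> with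
  \<open>v\<^sub>i\<close> orthogonal to \<open>e\<close>. Given the \<open>v\<^sub>i\<close>, the matrix \<open>N\<close> depends on the Gaussian vector \<open>x\<close> of
  length \<open>k\<close> only through \<open>\<Sum>x\<^sub>i\<^sup>2\<close> and \<open>\<Sum>x\<^sub>i v\<^sub>i\<close>. By rotation invariance, the second sum may
  be assumed to involve only the first \<open>d\<close> coordinates of \<open>x\<close>. Conditionally on these, \<open>N\<close> is a
  function of \<open>X\<close>, the sum of the squares of the remaining coordinates, and adding \<^term>\<open>outer a\<close> to \<open>N\<close>
  amounts to adding \<open>|a|\<^sup>2\<close> to \<open>X\<close>. One coordinate is discarded if necessary to make their number
  \<open>2 p\<close> even, so that \<open>X\<close> has an Erlang distribution; its density changes by a factor of
  at most \<open>exp (\<epsilon> / 2)\<close> under the shift where \<open>X\<close> is within a factor \<open>1 \<plusminus> \<epsilon> / 2\<close> of its mean, and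
  Chernoff's bound controls the rest.
\<close>

section \<open>Erlang distributions under a shift\<close>

lemma ln_one_minus_le_quadratic:
  fixes t :: real
  assumes "0 \<le> t" "t < 1"
  shows "ln (1 - t) \<le> - t - t\<^sup>2 / 2"
proof -
  have "(\<lambda>t. - t - t\<^sup>2 / 2 - ln (1 - t)) 0 \<le> (\<lambda>t. - t - t\<^sup>2 / 2 - ln (1 - t)) t"
  proof (rule DERIV_nonneg_imp_nondecreasing[OF assms(1)])
    fix x assume x: "0 \<le> x" "x \<le> t"
    have "((\<lambda>t. - t - t\<^sup>2 / 2 - ln (1 - t)) has_real_derivative - 1 - x + 1 / (1 - x)) (at x)"
      using x assms by (auto intro!: derivative_eq_intros)
    moreover have "0 \<le> - 1 - x + 1 / (1 - x)"
      using x assms by (simp add: field_simps)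
    ultimately show "\<exists>y. ((\<lambda>t. - t - t\<^sup>2 / 2 - ln (1 - t)) has_real_derivative y) (at x) \<and> 0 \<le> y"
      by blast
  qed
  then show ?thesis by simp
qed

text \<open>The derivative of the difference is \<open>x * (1 - 2 * x) / (3 * (1 + x))\<close>. The
  coefficient 1/3 and the range up to 1/2 belong together: up to there this is nonnegative.\<close>

lemma ln_one_plus_le_quadratic:
  fixes t :: real
  assumes "0 \<le> t" "t \<le> 1 / 2"
  shows "ln (1 + t) \<le> t - t\<^sup>2 / 3"
proof -
  have "(\<lambda>t. t - t\<^sup>2 / 3 - ln (1 + t)) 0 \<le> (\<lambda>t. t - t\<^sup>2 / 3 - ln (1 + t)) t"
  proof (rule DERIV_nonneg_imp_nondecreasing[OF assms(1)])
    fix x assume x: "0 \<le> x" "x \<le> t"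
    have "((\<lambda>t. t - t\<^sup>2 / 3 - ln (1 + t)) has_real_derivative 1 - 2 * x / 3 - 1 / (1 + x)) (at x)"
      using x assms by (auto intro!: derivative_eq_intros)
    moreover have "0 \<le> 1 - 2 * x / 3 - 1 / (1 + x)"
    proof -
      have "0 \<le> x * (1 - 2 * x)" using x assms by simp
      then show ?thesis using x by (simp add: field_simps)
    qed
    ultimately show "\<exists>y. ((\<lambda>t. t - t\<^sup>2 / 3 - ln (1 + t)) has_real_derivative y) (at x) \<and> 0 \<le> y"
      by blast
  qed
  then show ?thesis by simp
qed

text \<open>A pointwise form of the Erlang moment generating function: exponential tilting only
  changes the rate, and the power is the ratio of the normalizing constants.\<close>

lemma erlang_density_tilt:
  assumes "0 < l" "0 < l'"
  shows "exp ((l - l') * x) * erlang_density n l x = (l / l') ^ Suc n * erlang_density n l' x"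
proof -
  have "exp ((l - l') * x) * exp (- l * x) = exp (- l' * x)"
    by (simp add: exp_add[symmetric] algebra_simps)
  then show ?thesis
    using assms by (auto simp: erlang_density_def power_divide field_simps)
qed

text \<open>Chernoff's bound: on \<^term>\<open>T\<close> the tilting factor is at least \<^term>\<open>exp ((l - l') * a)\<close>.\<close>

lemma emeasure_erlang_chernoff:
  assumes l: "0 < l" "0 < l'" and T: "T \<in> sets borel" "\<And>x. x \<in> T \<Longrightarrow> (l - l') * a \<le> (l - l') * x"
  shows "emeasure (density lborel (erlang_density n l)) T
    \<le> ennreal ((l / l') ^ Suc n * exp (- ((l - l') * a)))"
proof -
  let ?C = "(l / l') ^ Suc n * exp (- ((l - l') * a))"
  have "erlang_density n l x \<le> ?C * erlang_density n l' x" if "x \<in> T" for x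
  proof -
    have "erlang_density n l x \<le> exp ((l - l') * x - (l - l') * a) * erlang_density n l x"
      using mult_right_mono[of 1 "exp ((l - l') * x - (l - l') * a)" "erlang_density n l x"]
        T(2)[OF that] l by simp
    also have "\<dots> = exp (- ((l - l') * a)) * (exp ((l - l') * x) * erlang_density n l x)"
      unfolding mult.assoc[symmetric] exp_add[symmetric] by (simp add: algebra_simps)
    also have "\<dots> = ?C * erlang_density n l' x"
      unfolding erlang_density_tilt[OF l] by (simp add: ac_simps)
    finally show ?thesis .
  qed
  then have "emeasure (density lborel (erlang_density n l)) T
    \<le> (\<integral>\<^sup>+x. ennreal ?C * ennreal (erlang_density n l' x) \<partial>lborel)"
    using T(1) l by (auto simp: emeasure_density ennreal_mult[symmetric]
        intro!: nn_integral_mono split: split_indicator)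
  also have "\<dots> = ennreal ?C * emeasure (density lborel (erlang_density n l')) (space (density lborel (erlang_density n l')))"
    by (simp add: emeasure_density nn_integral_cmult)
  also have "\<dots> = ennreal ?C"
    using prob_space.emeasure_space_1[OF prob_space_erlang_density[OF l(2)]] by simp
  finally show ?thesis .
qed

text \<open>Chernoff's bound with the tilted rate \<open>l / (1 - t)\<close>, chosen so that the
  tilted distribution has its mean exactly at the threshold. The upper tail uses
  \<open>l / (1 + t)\<close> in the same way.\<close>

lemma emeasure_erlang_lower_tail:
  fixes t :: real
  assumes l: "0 < l" and t: "0 \<le> t" "t < 1"
  shows "emeasure (density lborel (erlang_density n l)) {..< (1 - t) * Suc n / l}
    \<le> ennreal (exp (- (Suc n * t\<^sup>2 / 2)))"
proof -
  have "emeasure (density lborel (erlang_density n l)) {..< (1 - t) * Suc n / l}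
    \<le> ennreal ((l / (l / (1 - t))) ^ Suc n * exp (- ((l - l / (1 - t)) * ((1 - t) * Suc n / l))))"
  proof (rule emeasure_erlang_chernoff)
    have "l - l / (1 - t) \<le> 0" using l t by (simp add: field_simps)
    then show "(l - l / (1 - t)) * ((1 - t) * Suc n / l) \<le> (l - l / (1 - t)) * x"
      if "x \<in> {..< (1 - t) * Suc n / l}" for x
      using that by (intro mult_left_mono_neg) auto
  qed (use l t in auto)
  also have "(l / (l / (1 - t))) ^ Suc n * exp (- ((l - l / (1 - t)) * ((1 - t) * Suc n / l)))
    = (1 - t) ^ Suc n * exp (Suc n * t)"
  proof -
    have "l / (l / (1 - t)) = 1 - t" using l t by simp
    moreover have "(l - l / (1 - t)) * ((1 - t) * Suc n / l) = - (Suc n * t)"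
      using l t by (simp add: field_simps)
    ultimately show ?thesis by simp
  qed
  also have "\<dots> = exp (Suc n * (ln (1 - t) + t))"
    using t by (simp add: distrib_left exp_add exp_of_nat_mult del: of_nat_Suc power_Suc)
  also have "\<dots> \<le> exp (- (Suc n * t\<^sup>2 / 2))"
  proof -
    have "Suc n * (ln (1 - t) + t) \<le> Suc n * (- (t\<^sup>2 / 2))"
      using ln_one_minus_le_quadratic[OF t] by (intro mult_left_mono) auto
    then show ?thesis by simp
  qed
  finally show ?thesis by (simp add: ennreal_leI)
qed

lemma emeasure_erlang_upper_tail:
  fixes t :: real
  assumes l: "0 < l" and t: "0 \<le> t" "t \<le> 1 / 2"
  shows "emeasure (density lborel (erlang_density n l)) {(1 + t) * Suc n / l <..}
    \<le> ennreal (exp (- (Suc n * t\<^sup>2 / 3)))"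
proof -
  have "emeasure (density lborel (erlang_density n l)) {(1 + t) * Suc n / l <..}
    \<le> ennreal ((l / (l / (1 + t))) ^ Suc n * exp (- ((l - l / (1 + t)) * ((1 + t) * Suc n / l))))"
  proof (rule emeasure_erlang_chernoff)
    have "0 \<le> l - l / (1 + t)" using l t by (simp add: field_simps)
    then show "(l - l / (1 + t)) * ((1 + t) * Suc n / l) \<le> (l - l / (1 + t)) * x"
      if "x \<in> {(1 + t) * Suc n / l <..}" for x
      using that by (intro mult_left_mono) auto
  qed (use l t in auto)
  also have "(l / (l / (1 + t))) ^ Suc n * exp (- ((l - l / (1 + t)) * ((1 + t) * Suc n / l)))
    = (1 + t) ^ Suc n * exp (- (Suc n * t))"
  proof -
    have "l / (l / (1 + t)) = 1 + t" using l t by simp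
    moreover have "l - l / (1 + t) = l * t / (1 + t)"
      using t by (simp add: field_simps)
    then have "(l - l / (1 + t)) * ((1 + t) * Suc n / l) = Suc n * t"
      using l t by simp
    ultimately show ?thesis by simp
  qed
  also have "\<dots> = exp (Suc n * (ln (1 + t) - t))"
  proof -
    have "(1 + t) ^ Suc n = exp (Suc n * ln (1 + t))"
      unfolding exp_of_nat_mult using t by simp
    then show ?thesis
      by (simp add: exp_add[symmetric] right_diff_distrib del: of_nat_Suc power_Suc)
  qed
  also have "\<dots> \<le> exp (- (Suc n * t\<^sup>2 / 3))"
  proof -
    have "Suc n * (ln (1 + t) - t) \<le> Suc n * (- (t\<^sup>2 / 3))"
      using ln_one_plus_le_quadratic[OF t] by (intro mult_left_mono) auto
    then show ?thesis by simp
  qed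
  finally show ?thesis by (simp add: ennreal_leI)
qed

section \<open>Comparison of an Erlang distribution with its translates\<close>

text \<open>On \<open>G\<close> the pointwise ratio bound is integrated after the substitution of
  \<open>x + s1 - s2\<close> for \<open>x\<close>; the mass outside \<open>G\<close> is paid for by
  \<open>D\<close>. Having both shifts as parameters makes the two directions of the comparison
  instances of one statement.\<close>

lemma density_shift_le:
  fixes f :: "real \<Rightarrow> real" and s1 s2 :: real
  assumes [measurable]: "f \<in> borel_measurable borel" "T \<in> sets borel" "G \<in> sets borel"
    and f: "\<And>x. 0 \<le> f x" and K: "0 \<le> K"
    and ratio: "\<And>x. x \<in> G \<Longrightarrow> f x \<le> K * f (x + s1 - s2)"
    and tail: "emeasure (density lborel f) (- G) \<le> D"
  shows "(\<integral>\<^sup>+x. indicator T (x + s1) \<partial>density lborel f)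
    \<le> ennreal K * (\<integral>\<^sup>+x. indicator T (x + s2) \<partial>density lborel f) + D"
proof -
  have shift: "(\<integral>\<^sup>+x. ennreal (f (x + s1 - s2)) * indicator T (x + s1) \<partial>lborel)
    = (\<integral>\<^sup>+x. ennreal (f x) * indicator T (x + s2) \<partial>lborel)"
    using nn_integral_real_affine[of "\<lambda>x. ennreal (f x) * indicator T (x + s2)" 1 "s1 - s2"]
    by (simp add: one_ennreal_def[symmetric] algebra_simps)
  have "(\<integral>\<^sup>+x. indicator T (x + s1) \<partial>density lborel f)
    = (\<integral>\<^sup>+x. ennreal (f x) * indicator T (x + s1) \<partial>lborel)"
    by (simp add: nn_integral_density)
  also have "\<dots> \<le> (\<integral>\<^sup>+x. ennreal K * (ennreal (f (x + s1 - s2)) * indicator T (x + s1))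
        + ennreal (f x) * indicator (- G) x \<partial>lborel)"
    using ratio f K
    by (intro nn_integral_mono) (auto split: split_indicator simp: ennreal_mult[symmetric] ennreal_leI)
  also have "\<dots> = ennreal K * (\<integral>\<^sup>+x. ennreal (f (x + s1 - s2)) * indicator T (x + s1) \<partial>lborel)
        + emeasure (density lborel f) (- G)"
    by (simp add: nn_integral_add nn_integral_cmult emeasure_density)
  also have "\<dots> \<le> ennreal K * (\<integral>\<^sup>+x. indicator T (x + s2) \<partial>density lborel f) + D"
    unfolding shift using tail by (simp add: nn_integral_density add_left_mono)
  finally show ?thesis .
qed


text \<open>The ratio of the densities is \<open>(x / (x - s)) ^ n * exp (- l * s)\<close>. By
  \<open>1 + u \<le> exp u\<close> with \<open>u = s / (x - s)\<close> it suffices that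
  \<open>n * u \<le> l * s + \<epsilon> / 2\<close>, which holds when \<open>x\<close> is not far
  below the mean.\<close>

lemma erlang_density_le_shift_left:
  fixes \<epsilon> l s x :: real
  assumes \<epsilon>: "0 < \<epsilon>" "\<epsilon> < 1" and l: "0 < l" and s: "0 \<le> s" "l * s \<le> 1 / 2"
    and n: "5 \<le> \<epsilon> * Suc n" and x: "(1 - \<epsilon> / 2) * Suc n / l \<le> x"
  shows "erlang_density n l x \<le> exp (\<epsilon> / 2) * erlang_density n l (x - s)"
proof -
  define N where "N = real n"
  have zl: "(1 - \<epsilon> / 2) * (N + 1) \<le> l * x"
    using x l unfolding N_def by (simp add: field_simps)
  have "4 \<le> N" 
  proof -
    have "5 \<le> \<epsilon> * (N + 1)" using n by (simp add: N_def add.commute)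
    also have "\<dots> \<le> 1 * (N + 1)" using \<epsilon> by (intro mult_right_mono) (auto simp: N_def)
    finally show ?thesis by simp
  qed
  have "1 / 2 * (N + 1) \<le> (1 - \<epsilon> / 2) * (N + 1)"
    using \<epsilon> \<open>4 \<le> N\<close> by (intro mult_right_mono) auto
  from order_trans[OF this zl] have "N + 1 \<le> 2 * (l * x)" by simp
  then have "l * s < l * x" using s(2) \<open>4 \<le> N\<close> by simp
  then have xs: "s < x" using l by simp
  \<comment> \<open>The subtracted 1/2 makes room for \<open>l * s\<close>. The product
    \<open>(1 - \<epsilon> / 2) * (1 + \<epsilon>)\<close> exceeds 1 by
    \<open>\<epsilon> * (1 - \<epsilon>) / 2\<close>, which gives the leading term of the
    difference.\<close>
  have "N \<le> ((1 - \<epsilon> / 2) * (N + 1) - 1 / 2) * (1 + \<epsilon>)"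
  proof -
    have "((1 - \<epsilon> / 2) * (N + 1) - 1 / 2) * (1 + \<epsilon>) - N
      = N * (\<epsilon> * (1 - \<epsilon>)) / 2 + (1 - \<epsilon>) * (1 + \<epsilon>) / 2"
      by (simp add: field_simps)
    moreover have "0 \<le> N * (\<epsilon> * (1 - \<epsilon>))" "0 \<le> (1 - \<epsilon>) * (1 + \<epsilon>)"
      using \<epsilon> \<open>4 \<le> N\<close> by auto
    ultimately show ?thesis by linarith
  qed
  also have "\<dots> \<le> (l * x - l * s) * (1 + \<epsilon>)"
    using \<epsilon> zl s by (intro mult_right_mono) auto
  finally have "(l * s) * N \<le> (l * s) * ((l * x - l * s) * (1 + \<epsilon>))"
    using l s by (intro mult_left_mono) auto
  also have "\<dots> = (l * s * (1 + \<epsilon>)) * (l * x - l * s)"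
    by simp
  also have "\<dots> \<le> (l * s + \<epsilon> / 2) * (l * x - l * s)"
  proof (rule mult_right_mono)
    show "l * s * (1 + \<epsilon>) \<le> l * s + \<epsilon> / 2"
      using mult_right_mono[OF s(2), of \<epsilon>] \<epsilon> by (simp add: algebra_simps)
  qed (use \<open>l * s < l * x\<close> in simp)
  finally have "l * (N * s) \<le> l * ((l * s + \<epsilon> / 2) * (x - s))"
    by (simp only: right_diff_distrib[symmetric]) (simp only: mult_ac)
  then have "N * s \<le> (l * s + \<epsilon> / 2) * (x - s)"
    using l by simp
  then have key: "N * (s / (x - s)) \<le> l * s + \<epsilon> / 2"
    using xs by (simp add: field_simps)
  have "x = (1 + s / (x - s)) * (x - s)"
    using xs by (simp add: field_simps)
  also have "\<dots> \<le> exp (s / (x - s)) * (x - s)"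
    using xs by (intro mult_right_mono) auto
  finally have "x ^ n \<le> (exp (s / (x - s)) * (x - s)) ^ n"
    using xs s by (intro power_mono) auto
  also have "\<dots> = exp (N * (s / (x - s))) * (x - s) ^ n"
    unfolding N_def exp_of_nat_mult power_mult_distrib ..
  also have "\<dots> \<le> exp (l * s + \<epsilon> / 2) * (x - s) ^ n"
    using key xs by (intro mult_right_mono) auto
  finally have "x ^ n * exp (- l * x) \<le> exp (l * s + \<epsilon> / 2) * (x - s) ^ n * exp (- l * x)"
    by (intro mult_right_mono) auto
  also have "\<dots> = exp (\<epsilon> / 2) * ((x - s) ^ n * exp (- l * (x - s)))"
  proof -
    have "exp (l * s + \<epsilon> / 2) * exp (- l * x) = exp (\<epsilon> / 2) * exp (- l * (x - s))"
      unfolding exp_add[symmetric] by (simp add: algebra_simps)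
    from arg_cong[OF this, of "\<lambda>u. u * (x - s) ^ n"] show ?thesis by (simp only: mult_ac)
  qed
  finally have "l ^ Suc n / fact n * (x ^ n * exp (- l * x))
    \<le> l ^ Suc n / fact n * (exp (\<epsilon> / 2) * ((x - s) ^ n * exp (- l * (x - s))))"
    using l by (intro mult_left_mono) auto
  then show ?thesis
    using xs s by (simp add: erlang_density_def mult_ac)
qed

text \<open>Now the ratio is \<open>(x / (x + s)) ^ n * exp (l * s)\<close>, and
  \<open>1 - u \<le> exp (- u)\<close> with \<open>u = s / (x + s)\<close> reduces the claim to
  \<open>l * s - \<epsilon> / 2 \<le> n * u\<close>, which holds when \<open>x\<close> is not far
  above the mean.\<close>

lemma erlang_density_le_shift_right:
  fixes \<epsilon> l s x :: real
  assumes \<epsilon>: "0 < \<epsilon>" "\<epsilon> < 1" and l: "0 < l" and s: "0 \<le> s" "l * s \<le> 1 / 2"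
    and n: "5 \<le> \<epsilon> * Suc n" and x: "x \<le> (1 + \<epsilon> / 2) * Suc n / l"
  shows "erlang_density n l x \<le> exp (\<epsilon> / 2) * erlang_density n l (x + s)"
\<comment> \<open>These cases are split off so that \<open>x + s\<close> is positive and can be
  divided by; for negative \<open>x\<close> the left density vanishes.\<close>
proof (cases "x < 0 \<or> s = 0")
  case True
  then show ?thesis
  proof
    assume "s = 0"
    then show ?thesis
      using mult_right_mono[of 1 "exp (\<epsilon> / 2)" "erlang_density n l x"] \<epsilon> l by simp
  qed (use l in \<open>auto simp: erlang_density_def\<close>)
next
  case False
  then have x0: "0 \<le> x" "0 < x + s" using s by auto
  define N where "N = real n"
  have N: "0 \<le> N" by (simp add: N_def)
  have zl: "l * x \<le> (1 + \<epsilon> / 2) * (N + 1)"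
    using x l unfolding N_def by (simp add: field_simps)
  \<comment> \<open>The constant 5 is what makes the next difference nonnegative: half of it covers
    \<open>\<epsilon> + 3 / 2\<close>, because \<open>\<epsilon> < 1\<close>.\<close>
  have "5 \<le> \<epsilon> * (N + 1)" using n by (simp add: N_def add.commute)
  moreover have "N * (1 + \<epsilon>) - ((1 + \<epsilon> / 2) * (N + 1) + 1 / 2) = \<epsilon> * (N + 1) / 2 - \<epsilon> - 3 / 2"
    by (simp add: field_simps)
  ultimately have "(1 + \<epsilon> / 2) * (N + 1) + 1 / 2 \<le> N * (1 + \<epsilon>)"
    using \<epsilon> by linarith
  then have zb: "l * x + l * s \<le> N * (1 + \<epsilon>)" using zl s by linarith
  have "(l * s - \<epsilon> / 2) * (l * x + l * s) \<le> (l * s * (1 - \<epsilon>)) * (l * x + l * s)"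
    using mult_right_mono[OF s(2), of \<epsilon>] \<epsilon> l s x0 by (intro mult_right_mono) (auto simp: algebra_simps)
  also have "\<dots> \<le> (l * s * (1 - \<epsilon>)) * (N * (1 + \<epsilon>))"
    using zb \<epsilon> l s by (intro mult_left_mono) auto
  also have "\<dots> = l * s * N * (1 - \<epsilon>\<^sup>2)"
    by (simp add: algebra_simps power2_eq_square)
  also have "\<dots> \<le> l * s * N * 1"
    using l s N by (intro mult_left_mono) auto
  finally have "l * ((l * s - \<epsilon> / 2) * (x + s)) \<le> l * (N * s)"
    by (simp only: distrib_left[symmetric] mult_1_right) (simp only: mult_ac)
  then have "(l * s - \<epsilon> / 2) * (x + s) \<le> N * s"
    using l by simp
  then have key: "l * s - \<epsilon> / 2 \<le> N * (s / (x + s))"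
    using x0 by (simp add: field_simps)
  have "x = (1 + - (s / (x + s))) * (x + s)"
    using x0 by (simp add: field_simps)
  also have "\<dots> \<le> exp (- (s / (x + s))) * (x + s)"
    using x0 by (intro mult_right_mono exp_ge_add_one_self) auto
  finally have "x ^ n \<le> (exp (- (s / (x + s))) * (x + s)) ^ n"
    using x0 s by (intro power_mono) auto
  also have "\<dots> = exp (- (N * (s / (x + s)))) * (x + s) ^ n"
    using exp_of_nat_mult[of n "- (s / (x + s))"] by (simp add: N_def power_mult_distrib)
  also have "\<dots> \<le> exp (\<epsilon> / 2 - l * s) * (x + s) ^ n"
    using key x0 by (intro mult_right_mono) auto
  finally have "x ^ n * exp (- l * x) \<le> exp (\<epsilon> / 2 - l * s) * (x + s) ^ n * exp (- l * x)"
    by (intro mult_right_mono) auto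
  also have "\<dots> = exp (\<epsilon> / 2) * ((x + s) ^ n * exp (- l * (x + s)))"
  proof -
    have "exp (\<epsilon> / 2 - l * s) * exp (- l * x) = exp (\<epsilon> / 2) * exp (- l * (x + s))"
      unfolding exp_add[symmetric] by (simp add: algebra_simps)
    from arg_cong[OF this, of "\<lambda>u. u * (x + s) ^ n"] show ?thesis by (simp only: mult_ac)
  qed
  finally have "l ^ Suc n / fact n * (x ^ n * exp (- l * x))
    \<le> l ^ Suc n / fact n * (exp (\<epsilon> / 2) * ((x + s) ^ n * exp (- l * (x + s))))"
    using l by (intro mult_left_mono) auto
  then show ?thesis
    using x0 s by (simp add: erlang_density_def mult_ac)
qed

text \<open>The good sets are opposite half-lines: moving the argument of the density down is
  harmless for large \<open>x\<close>, moving it up for small \<open>x\<close>. With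
  \<open>t = \<epsilon> / 2\<close> the lower and upper tail exponents are
  \<open>\<epsilon>\<^sup>2 * Suc n / 8\<close> and \<open>\<epsilon>\<^sup>2 * Suc n / 12\<close>;
  the smaller one dictates the factor 12. The unshifted integrals are written with
  \<open>x + 0\<close> to fit the pattern with two shifts.\<close>

lemma
  fixes \<epsilon> l s L :: real
  assumes \<epsilon>: "0 < \<epsilon>" "\<epsilon> < 1" and l: "0 < l" and s: "0 \<le> s" "l * s \<le> 1 / 2"
    and n: "5 \<le> \<epsilon> * Suc n" "12 * L \<le> \<epsilon>\<^sup>2 * Suc n" and T: "T \<in> sets borel"
  shows erlang_le_shifted:
      "(\<integral>\<^sup>+x. indicator T (x + 0) \<partial>density lborel (erlang_density n l))
        \<le> ennreal (exp (\<epsilon> / 2)) * (\<integral>\<^sup>+x. indicator T (x + s) \<partial>density lborel (erlang_density n l))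
          + ennreal (exp (- L))"
    and shifted_erlang_le:
      "(\<integral>\<^sup>+x. indicator T (x + s) \<partial>density lborel (erlang_density n l))
        \<le> ennreal (exp (\<epsilon> / 2)) * (\<integral>\<^sup>+x. indicator T (x + 0) \<partial>density lborel (erlang_density n l))
          + ennreal (exp (- L))"
proof -
  have "L \<le> Suc n * (\<epsilon> / 2)\<^sup>2 / 3" using n(2) by (simp add: power_divide mult.commute)
  moreover have "y / 3 \<le> y / 2" if "0 \<le> y" for y :: real using that by simp
  from this[of "Suc n * (\<epsilon> / 2)\<^sup>2"] have "Suc n * (\<epsilon> / 2)\<^sup>2 / 3 \<le> Suc n * (\<epsilon> / 2)\<^sup>2 / 2"
    by simp
  ultimately have L: "exp (- (Suc n * (\<epsilon> / 2)\<^sup>2 / 3)) \<le> exp (- L)" "exp (- (Suc n * (\<epsilon> / 2)\<^sup>2 / 2)) \<le> exp (- L)"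
    unfolding exp_le_cancel_iff by linarith+
  show "(\<integral>\<^sup>+x. indicator T (x + 0) \<partial>density lborel (erlang_density n l))
        \<le> ennreal (exp (\<epsilon> / 2)) * (\<integral>\<^sup>+x. indicator T (x + s) \<partial>density lborel (erlang_density n l))
          + ennreal (exp (- L))"
  proof (rule density_shift_le)
    show "erlang_density n l x \<le> exp (\<epsilon> / 2) * erlang_density n l (x + 0 - s)"
      if "x \<in> {(1 - \<epsilon> / 2) * Suc n / l ..}" for x
      using erlang_density_le_shift_left[OF \<epsilon> l s n(1)] that by simp
    have "- {(1 - \<epsilon> / 2) * Suc n / l ..} = {..< (1 - \<epsilon> / 2) * Suc n / l}" by auto
    then show "emeasure (density lborel (erlang_density n l)) (- {(1 - \<epsilon> / 2) * Suc n / l ..})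
        \<le> ennreal (exp (- L))"
      using order_trans[OF emeasure_erlang_lower_tail[OF l, of "\<epsilon> / 2" n] ennreal_leI[OF L(2)]] \<epsilon> by simp
  qed (use T l in auto)
  show "(\<integral>\<^sup>+x. indicator T (x + s) \<partial>density lborel (erlang_density n l))
        \<le> ennreal (exp (\<epsilon> / 2)) * (\<integral>\<^sup>+x. indicator T (x + 0) \<partial>density lborel (erlang_density n l))
          + ennreal (exp (- L))"
  proof (rule density_shift_le)
    show "erlang_density n l x \<le> exp (\<epsilon> / 2) * erlang_density n l (x + s - 0)"
      if "x \<in> {.. (1 + \<epsilon> / 2) * Suc n / l}" for x
      using erlang_density_le_shift_right[OF \<epsilon> l s n(1)] that by simp
    have "- {.. (1 + \<epsilon> / 2) * Suc n / l} = {(1 + \<epsilon> / 2) * Suc n / l <..}" by auto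
    then show "emeasure (density lborel (erlang_density n l)) (- {.. (1 + \<epsilon> / 2) * Suc n / l})
        \<le> ennreal (exp (- L))"
      using order_trans[OF emeasure_erlang_upper_tail[OF l, of "\<epsilon> / 2" n] ennreal_leI[OF L(1)]] \<epsilon> by simp
  qed (use T l in auto)
qed

section \<open>Rotations and sums of squares of Gaussians\<close>

lemma nn_integral_lborel_translate:
  fixes f :: "'a::euclidean_space \<Rightarrow> ennreal"
  assumes "f \<in> borel_measurable borel"
  shows "(\<integral>\<^sup>+x. f (c + x) \<partial>lborel) = (\<integral>\<^sup>+x. f x \<partial>lborel)"
proof -
  have "(lborel :: 'a measure) = distr lborel borel (\<lambda>x. c + x)"
    using lborel_affine[of 1 c] by (simp add: density_1)
  then have "(\<integral>\<^sup>+x. f x \<partial>lborel) = (\<integral>\<^sup>+x. f x \<partial>distr lborel borel (\<lambda>x. c + x))"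
    by simp
  then show ?thesis using assms by (simp add: nn_integral_distr)
qed

lemma nn_integral_lborel_reflect:
  fixes f :: "'a::euclidean_space \<Rightarrow> ennreal"
  assumes "f \<in> borel_measurable borel"
  shows "(\<integral>\<^sup>+x. f (c - x) \<partial>lborel) = (\<integral>\<^sup>+x. f x \<partial>lborel)"
proof -
  have "(lborel :: 'a measure) = distr lborel borel (\<lambda>x. c - x)"
    using lborel_affine[of "-1" c] by (simp add: density_1)
  then have "(\<integral>\<^sup>+x. f x \<partial>lborel) = (\<integral>\<^sup>+x. f x \<partial>distr lborel borel (\<lambda>x. c - x))"
    by simp
  then show ?thesis using assms by (simp add: nn_integral_distr)
qed

lemma orthogonal_transformation_borel_measurable:
  "orthogonal_transformation f \<Longrightarrow> f \<in> borel_measurable borel" for f :: "'a::euclidean_space \<Rightarrow> 'a"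
  by (intro borel_measurable_continuous_onI linear_continuous_on
      linear_conv_bounded_linear[THEN iffD1] orthogonal_transformation_linear)

text \<open>The image measure is translation invariant, and two translation invariant measures are
  proportional by Tonelli's theorem; the unit ball fixes the constant.\<close>

lemma emeasure_lborel_orthogonal_vimage:
  fixes f :: "'a::euclidean_space \<Rightarrow> 'a"
  assumes f: "orthogonal_transformation f" and [measurable]: "A \<in> sets borel"
  shows "emeasure lborel (f -` A) = emeasure lborel A"
proof -
  have lin: "linear f" using f by (rule orthogonal_transformation_linear)
  note [measurable] = orthogonal_transformation_borel_measurable[OF f]
  define B :: "'a set" where "B = cball 0 1"
  have [measurable]: "B \<in> sets borel" by (simp add: B_def)
  have "(\<integral>\<^sup>+y. \<integral>\<^sup>+x. indicator A (f x) * indicator B (f x + y) \<partial>lborel \<partial>lborel)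
    = (\<integral>\<^sup>+x. \<integral>\<^sup>+y. indicator A (f x) * indicator B (f x + y) \<partial>lborel \<partial>lborel)"
    by (rule lborel_pair.Fubini') measurable
  also have "\<dots> = (\<integral>\<^sup>+x. indicator A (f x) * emeasure lborel B \<partial>lborel)"
    by (simp add: nn_integral_cmult nn_integral_lborel_translate[where f="indicator B"])
  also have "\<dots> = (\<integral>\<^sup>+x. indicator (f -` A) x \<partial>lborel) * emeasure lborel B"
    by (simp add: nn_integral_multc indicator_vimage)
  finally have 1: "(\<integral>\<^sup>+y. \<integral>\<^sup>+x. indicator A (f x) * indicator B (f x + y) \<partial>lborel \<partial>lborel)
    = emeasure lborel (f -` A) * emeasure lborel B"
    using measurable_sets_borel[of f borel A] by simp
  have "(\<integral>\<^sup>+x. indicator A (f x) * indicator B (f x + y) \<partial>lborel)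
    = (\<integral>\<^sup>+x. indicator A (f x - y) * indicator B (f x) \<partial>lborel)" (is "?l = ?r") for y
  proof -
    \<comment> \<open>Translating the image by \<open>y\<close> amounts to translating the argument
      by a preimage of \<open>y\<close>, so translation invariance passes from Lebesgue measure to
      its image.\<close>
    obtain z where z: "f z = y" using orthogonal_transformation_surj[OF f] by (metis surjD)
    have "?l = (\<integral>\<^sup>+x. indicator A (f (- z + x)) * indicator B (f (- z + x) + y) \<partial>lborel)"
      by (rule nn_integral_lborel_translate[symmetric]) measurable
    also have "\<dots> = ?r"
      by (simp add: linear_add[OF lin] linear_diff[OF lin] linear_neg[OF lin] z)
    finally show ?thesis .
  qed
  then have "(\<integral>\<^sup>+y. \<integral>\<^sup>+x. indicator A (f x) * indicator B (f x + y) \<partial>lborel \<partial>lborel)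
    = (\<integral>\<^sup>+y. \<integral>\<^sup>+x. indicator A (f x - y) * indicator B (f x) \<partial>lborel \<partial>lborel)"
    by simp
  also have "\<dots> = (\<integral>\<^sup>+x. \<integral>\<^sup>+y. indicator A (f x - y) * indicator B (f x) \<partial>lborel \<partial>lborel)"
    by (rule lborel_pair.Fubini') measurable
  also have "\<dots> = (\<integral>\<^sup>+x. emeasure lborel A * indicator B (f x) \<partial>lborel)"
    by (simp add: nn_integral_multc nn_integral_lborel_reflect[where f="indicator A"])
  also have "\<dots> = emeasure lborel A * (\<integral>\<^sup>+x. indicator (f -` B) x \<partial>lborel)"
    by (simp add: nn_integral_cmult indicator_vimage)
  also have "f -` B = B"
    using f by (auto simp: B_def orthogonal_transformation_norm)
  finally have "emeasure lborel (f -` A) * emeasure lborel B = emeasure lborel A * emeasure lborel B"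
    using 1 by simp
  moreover have "emeasure lborel B \<noteq> 0" "emeasure lborel B \<noteq> top"
    using unit_ball_vol_pos[of "real DIM('a)"]
    by (simp_all add: B_def emeasure_cball less_imp_neq[symmetric])
  ultimately show ?thesis
    by (metis ennreal_mult_cancel_left mult.commute)
qed

lemma distr_lborel_orthogonal_transformation:
  fixes f :: "'a::euclidean_space \<Rightarrow> 'a"
  assumes f: "orthogonal_transformation f"
  shows "distr lborel borel f = lborel"
proof (rule measure_eqI)
  show "emeasure (distr lborel borel f) A = emeasure lborel A"
    if "A \<in> sets (distr lborel borel f)" for A
    using that emeasure_lborel_orthogonal_vimage[OF f, of A] orthogonal_transformation_borel_measurable[OF f]
    by (simp add: emeasure_distr)
qed simp

section \<open>Pairs of Gaussians and sums of squares\<close>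

abbreviation normal :: "real \<Rightarrow> real measure" where
  "normal \<sigma> \<equiv> density lborel (\<lambda>x. ennreal (normal_density 0 \<sigma> x))"

text \<open>The joint density is a function of the norm alone. This yields both rotation invariance
  in the plane and the law of the squared radius.\<close>

lemma nn_integral_normal_pair:
  assumes [measurable]: "f \<in> borel_measurable borel" and \<sigma>: "0 < \<sigma>"
  shows "(\<integral>\<^sup>+x. \<integral>\<^sup>+y. f (x, y) \<partial>normal \<sigma> \<partial>normal \<sigma>)
    = (\<integral>\<^sup>+z. ennreal (exp (- (norm z)\<^sup>2 / (2 * \<sigma>\<^sup>2)) / (2 * pi * \<sigma>\<^sup>2)) * f z \<partial>lborel)"
proof -
  have [measurable]: "f \<in> borel_measurable (borel \<Otimes>\<^sub>M borel)"
    by (simp add: borel_prod)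
  have dens: "normal_density 0 \<sigma> x * normal_density 0 \<sigma> y
      = exp (- (norm (x, y))\<^sup>2 / (2 * \<sigma>\<^sup>2)) / (2 * pi * \<sigma>\<^sup>2)" for x y
  proof -
    have "- (norm (x, y))\<^sup>2 / (2 * \<sigma>\<^sup>2) = - x\<^sup>2 / (2 * \<sigma>\<^sup>2) + - y\<^sup>2 / (2 * \<sigma>\<^sup>2)"
      by (simp add: norm_Pair diff_divide_distrib)
    then have "exp (- (norm (x, y))\<^sup>2 / (2 * \<sigma>\<^sup>2)) = exp (- x\<^sup>2 / (2 * \<sigma>\<^sup>2)) * exp (- y\<^sup>2 / (2 * \<sigma>\<^sup>2))"
      by (simp only: exp_add)
    then show ?thesis
      by (simp add: normal_density_def)
  qed
  have "(\<integral>\<^sup>+x. \<integral>\<^sup>+y. f (x, y) \<partial>normal \<sigma> \<partial>normal \<sigma>)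
    = (\<integral>\<^sup>+x. \<integral>\<^sup>+y. ennreal (normal_density 0 \<sigma> x * normal_density 0 \<sigma> y) * f (x, y) \<partial>lborel \<partial>lborel)"
    by (simp add: nn_integral_density nn_integral_cmult[symmetric] ennreal_mult mult.assoc)
  also have "\<dots> = (\<integral>\<^sup>+z. ennreal (exp (- (norm z)\<^sup>2 / (2 * \<sigma>\<^sup>2)) / (2 * pi * \<sigma>\<^sup>2)) * f z \<partial>(lborel \<Otimes>\<^sub>M lborel))"
    unfolding dens by (subst lborel.nn_integral_fst[symmetric]) (auto simp: borel_prod lborel_prod)
  finally show ?thesis by (simp add: lborel_prod)
qed

lemma nn_integral_normal_pair_orthogonal:
  fixes R :: "real \<times> real \<Rightarrow> real \<times> real"
  assumes [measurable]: "f \<in> borel_measurable borel" and \<sigma>: "0 < \<sigma>"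
    and R: "orthogonal_transformation R"
  shows "(\<integral>\<^sup>+x. \<integral>\<^sup>+y. f (R (x, y)) \<partial>normal \<sigma> \<partial>normal \<sigma>) = (\<integral>\<^sup>+x. \<integral>\<^sup>+y. f (x, y) \<partial>normal \<sigma> \<partial>normal \<sigma>)"
proof -
  note [measurable] = orthogonal_transformation_borel_measurable[OF R]
  let ?g = "\<lambda>z :: real \<times> real. ennreal (exp (- (norm z)\<^sup>2 / (2 * \<sigma>\<^sup>2)) / (2 * pi * \<sigma>\<^sup>2))"
  have "(\<integral>\<^sup>+z. ?g z * f z \<partial>lborel) = (\<integral>\<^sup>+z. ?g z * f z \<partial>distr lborel borel R)"
    by (simp add: distr_lborel_orthogonal_transformation[OF R])
  also have "\<dots> = (\<integral>\<^sup>+z. ?g z * f (R z) \<partial>lborel)"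
    by (subst nn_integral_distr) (auto simp: orthogonal_transformation_norm[OF R])
  finally show ?thesis
    using \<sigma> by (simp add: nn_integral_normal_pair nn_integral_normal_pair[of "\<lambda>z. f (R z)"])
qed

text \<open>Polar coordinates without a Jacobian: the disc of squared radius \<open>t\<close> has
  area \<open>pi * t\<close>, and measures that are finite on the half-lines \<open>{..t}\<close>
  are determined by their values there.\<close>

lemma distr_lborel_norm_square:
  "distr (lborel :: (real \<times> real) measure) borel (\<lambda>z. (norm z)\<^sup>2)
    = density lborel (\<lambda>t. ennreal pi * indicator {0..} t)" (is "?M = ?N")
proof (rule measure_eqI_generator_eq)
  have M: "emeasure ?M {..t} = (if 0 \<le> t then ennreal (pi * t) else 0)" for t
  proof (cases "0 \<le> t")
    case True
    have "(\<lambda>z :: real \<times> real. (norm z)\<^sup>2) -` {..t} = cball 0 (sqrt t)"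
      using real_le_rsqrt real_sqrt_le_iff True by (auto simp: real_le_lsqrt real_le_rsqrt sqrt_ge_absD)
    then show ?thesis using True
      by (simp add: emeasure_distr emeasure_cball unit_ball_vol_2)
  next
    case False
    then have "(\<lambda>z :: real \<times> real. (norm z)\<^sup>2) -` {..t} = {}"
      by (auto simp: not_le) (meson less_le_trans not_less zero_le_power2)
    then show ?thesis using False by (simp add: emeasure_distr)
  qed
  have N: "emeasure ?N {..t} = (if 0 \<le> t then ennreal (pi * t) else 0)" for t
  proof -
    have "emeasure ?N {..t} = ennreal pi * emeasure lborel ({0..} \<inter> {..t})"
      by (simp add: emeasure_density mult.assoc nn_integral_cmult indicator_inter_arith[symmetric])
    also have "{0..} \<inter> {..t} = {0..t}" by auto
    finally show ?thesis by (auto simp: ennreal_mult)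
  qed
  show "emeasure ?M X = emeasure ?N X" if "X \<in> range (\<lambda>t::real. {..t})" for X
    using that M N by auto
  show "emeasure ?M ({..real i}) \<noteq> \<infinity>" for i by (simp add: M)
  show "Int_stable (range (\<lambda>t::real. {..t}))" by (auto simp: Int_stable_def)
  show "(\<Union>i. {..real i}) = UNIV" by (auto intro: real_arch_simple)
qed (auto simp: borel_eq_atMost)

lemma nn_integral_normal_pair_square:
  assumes [measurable]: "f \<in> borel_measurable borel" and \<sigma>: "0 < \<sigma>"
  shows "(\<integral>\<^sup>+x. \<integral>\<^sup>+y. f (x\<^sup>2 + y\<^sup>2) \<partial>normal \<sigma> \<partial>normal \<sigma>)
    = (\<integral>\<^sup>+t. f t \<partial>density lborel (erlang_density 0 (1 / (2 * \<sigma>\<^sup>2))))"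
proof -
  let ?g = "\<lambda>t. exp (- t / (2 * \<sigma>\<^sup>2)) / (2 * pi * \<sigma>\<^sup>2)"
  have "(\<integral>\<^sup>+x. \<integral>\<^sup>+y. f (x\<^sup>2 + y\<^sup>2) \<partial>normal \<sigma> \<partial>normal \<sigma>)
    = (\<integral>\<^sup>+z. ennreal (?g ((norm z)\<^sup>2)) * f ((norm z)\<^sup>2) \<partial>(lborel :: (real \<times> real) measure))"
    using nn_integral_normal_pair[of "\<lambda>z. f ((norm z)\<^sup>2)" \<sigma>] \<sigma> by (simp add: norm_Pair)
  also have "\<dots> = (\<integral>\<^sup>+t. ennreal (?g t) * f t \<partial>distr (lborel :: (real \<times> real) measure) borel (\<lambda>z. (norm z)\<^sup>2))"
    by (subst nn_integral_distr) auto
  also have "\<dots> = (\<integral>\<^sup>+t. (ennreal pi * indicator {0..} t) * (ennreal (?g t) * f t) \<partial>lborel)"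
    unfolding distr_lborel_norm_square by (rule nn_integral_density) auto
  also have "\<dots> = (\<integral>\<^sup>+t. ennreal (erlang_density 0 (1 / (2 * \<sigma>\<^sup>2)) t) * f t \<partial>lborel)"
  proof (rule nn_integral_cong)
    fix t :: real
    have "pi * ?g t = exp (- t / (2 * \<sigma>\<^sup>2)) / (2 * \<sigma>\<^sup>2)" by simp
    then show "(ennreal pi * indicator {0..} t) * (ennreal (?g t) * f t)
      = ennreal (erlang_density 0 (1 / (2 * \<sigma>\<^sup>2)) t) * f t"
      by (auto simp: erlang_density_def mult.assoc[symmetric] ennreal_mult[symmetric] split: split_indicator)
  qed
  finally show ?thesis by (simp add: nn_integral_density)
qed

lemma product_sigma_finite_normal: "0 < \<sigma> \<Longrightarrow> product_sigma_finite (\<lambda>_. normal \<sigma>)"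
  by (simp add: product_sigma_finite_def prob_space_normal_density prob_space_imp_sigma_finite)

text \<open>Coordinates are taken in pairs. The squares of one pair add up to an exponential
  variable, which is \<open>erlang_density 0\<close>, and convolving with it raises the Erlang
  parameter by one.\<close>

lemma nn_integral_normal_sum_squares:
  fixes I :: "'i set"
  assumes \<sigma>: "0 < \<sigma>" and "finite I" "card I = 2 * Suc n" and "f \<in> borel_measurable borel"
  shows "(\<integral>\<^sup>+x. f (\<Sum>i\<in>I. (x i)\<^sup>2) \<partial>PiM I (\<lambda>_. normal \<sigma>))
    = (\<integral>\<^sup>+t. f t \<partial>density lborel (erlang_density n (1 / (2 * \<sigma>\<^sup>2))))"
  using assms(2-)
proof (induction n arbitrary: I f)
  interpret product_sigma_finite "\<lambda>_::'i. normal \<sigma>"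
    by (rule product_sigma_finite_normal[OF \<sigma>])
  \<comment> \<open>Integrating out two coordinates serves both the base case, with \<open>J\<close>
    empty, and the induction step.\<close>
  have two: "(\<integral>\<^sup>+x. g (\<Sum>i\<in>insert a (insert b J). (x i)\<^sup>2) \<partial>PiM (insert a (insert b J)) (\<lambda>_. normal \<sigma>))
    = (\<integral>\<^sup>+x. \<integral>\<^sup>+t. g (t + (\<Sum>i\<in>J. (x i)\<^sup>2)) \<partial>density lborel (erlang_density 0 (1 / (2 * \<sigma>\<^sup>2))) \<partial>PiM J (\<lambda>_. normal \<sigma>))"
    if J: "finite J" "a \<notin> J" "b \<notin> J" "a \<noteq> b" and [measurable]: "g \<in> borel_measurable borel"
    for a b :: 'i and J and g :: "real \<Rightarrow> ennreal"
  proof -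
    have [simp]: "(\<Sum>i\<in>J. (if i = a then u else (x(b := v)) i)\<^sup>2) = (\<Sum>i\<in>J. (x i)\<^sup>2)"
      "(\<Sum>i\<in>J. (if i = b then v else x i)\<^sup>2) = (\<Sum>i\<in>J. (x i)\<^sup>2)" for u v :: real and x
      using J by (auto intro!: sum.cong)
    have "(\<integral>\<^sup>+x. g (\<Sum>i\<in>insert a (insert b J). (x i)\<^sup>2) \<partial>PiM (insert a (insert b J)) (\<lambda>_. normal \<sigma>))
      = (\<integral>\<^sup>+x. \<integral>\<^sup>+v. \<integral>\<^sup>+u. g (u\<^sup>2 + v\<^sup>2 + (\<Sum>i\<in>J. (x i)\<^sup>2)) \<partial>normal \<sigma> \<partial>normal \<sigma> \<partial>PiM J (\<lambda>_. normal \<sigma>))"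
      using J by (simp add: product_nn_integral_insert add.assoc)
    also have "\<dots> = (\<integral>\<^sup>+x. \<integral>\<^sup>+t. g (t + (\<Sum>i\<in>J. (x i)\<^sup>2)) \<partial>density lborel (erlang_density 0 (1 / (2 * \<sigma>\<^sup>2))) \<partial>PiM J (\<lambda>_. normal \<sigma>))"
      using nn_integral_normal_pair_square[OF _ \<sigma>, of "\<lambda>t. g (t + (\<Sum>i\<in>J. (x i)\<^sup>2))" for x]
      by (simp add: add.commute[of "_\<^sup>2" "_\<^sup>2"])
    finally show ?thesis .
  qed
  have split: "\<exists>a b J. I = insert a (insert b J) \<and> finite J \<and> a \<notin> J \<and> b \<notin> J \<and> a \<noteq> b \<and> card J = 2 * n"
    if "finite I" "card I = 2 * Suc n" for I :: "'i set" and n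
  proof -
    have "card I = Suc (Suc (2 * n))" using that by simp
    from card_eq_SucD[OF this] obtain a J' where a: "I = insert a J'" "a \<notin> J'" "card J' = Suc (2 * n)"
      by auto
    from card_eq_SucD[OF a(3)] obtain b J where b: "J' = insert b J" "b \<notin> J" "card J = 2 * n"
      by auto
    show ?thesis using a b that by auto
  qed
  {
    case 0
    then obtain a b :: 'i where I: "I = {a, b}" "a \<noteq> b"
      using split[of I 0] by auto
    show ?case
      using two[of "{}" a b f] I 0 by (simp add: PiM_empty)
  next
    case (Suc n)
    let ?l = "1 / (2 * \<sigma>\<^sup>2)"
    have l: "0 < ?l" using \<sigma> by simp
    note [measurable] = Suc.prems(3)
    obtain a b :: 'i and J where I: "I = insert a (insert b J)" "finite J" "a \<notin> J" "b \<notin> J" "a \<noteq> b"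
      "card J = 2 * Suc n" using split[of I "Suc n"] Suc.prems by auto
    have fin: "finite_measure (density lborel (erlang_density m ?l))" for m
      using prob_space_erlang_density[OF l] by (simp add: prob_space.finite_measure)
    interpret E: prob_space "density lborel (erlang_density 0 ?l)" by (rule prob_space_erlang_density[OF l])
    have "(\<integral>\<^sup>+x. f (\<Sum>i\<in>I. (x i)\<^sup>2) \<partial>PiM I (\<lambda>_. normal \<sigma>))
      = (\<integral>\<^sup>+x. \<integral>\<^sup>+t. f (t + (\<Sum>i\<in>J. (x i)\<^sup>2)) \<partial>density lborel (erlang_density 0 ?l) \<partial>PiM J (\<lambda>_. normal \<sigma>))"
      unfolding I(1) using I by (intro two) auto
    also have "\<dots> = (\<integral>\<^sup>+s. \<integral>\<^sup>+t. f (t + s) \<partial>density lborel (erlang_density 0 ?l) \<partial>density lborel (erlang_density n ?l))"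
      by (rule Suc.IH[OF I(2,6)]) measurable
    also have "\<dots> = (\<integral>\<^sup>+x. f x \<partial>convolution (density lborel (erlang_density n ?l)) (density lborel (erlang_density 0 ?l)))"
      by (subst nn_integral_convolution) (auto simp: fin add.commute)
    also have "convolution (density lborel (erlang_density n ?l)) (density lborel (erlang_density 0 ?l))
      = density lborel (erlang_density (Suc n) ?l)"
      using convolution_erlang_density[OF l, of n 0] by (subst convolution_density) (auto simp: fin)
    finally show ?case .
  }
qed

section \<open>Isotropic Gaussian vectors\<close>

lemma borel_measurable_vec_lambda:
  fixes f :: "'a \<Rightarrow> 'd::finite \<Rightarrow> real"
  assumes "\<And>i. (\<lambda>x. f x i) \<in> borel_measurable M"
  shows "(\<lambda>x. \<chi> i. f x i) \<in> borel_measurable M"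
  using assms by (subst borel_measurable_euclidean_space) (auto simp: Basis_vec_def inner_axis)

lemma borel_measurable_vec_nth[measurable (raw)]:
  fixes f :: "'a \<Rightarrow> real^'d"
  assumes [measurable]: "f \<in> borel_measurable M"
  shows "(\<lambda>x. f x $ i) \<in> borel_measurable M"
  unfolding cart_eq_inner_axis by measurable

text \<open>The radial form gives invariance under rotations, the product form gives independence of
  the coordinates.\<close>

lemma mvnormal_density_isotropic:
  fixes x :: "real^'d"
  assumes \<sigma>: "0 < \<sigma>"
  shows "mvnormal_density (\<sigma>\<^sup>2 *\<^sub>R mat 1) x = exp (- (norm x)\<^sup>2 / (2 * \<sigma>\<^sup>2)) / sqrt ((2 * pi * \<sigma>\<^sup>2) ^ CARD('d))"
    and "mvnormal_density (\<sigma>\<^sup>2 *\<^sub>R mat 1) x = (\<Prod>i\<in>UNIV. normal_density 0 \<sigma> (x $ i))"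
proof -
  let ?V = "\<sigma>\<^sup>2 *\<^sub>R mat 1 :: real^'d^'d"
  have mult: "(c *\<^sub>R mat 1 :: real^'d^'d) ** A = c *\<^sub>R A" for c and A :: "real^'d^'d"
    by (simp add: vec_eq_iff matrix_matrix_mult_def mat_def if_distrib[where f="\<lambda>u. c * u * _"] cong: if_cong)
  have "?V ** ((1 / \<sigma>\<^sup>2) *\<^sub>R mat 1) = mat 1" "((1 / \<sigma>\<^sup>2) *\<^sub>R mat 1) ** ?V = mat 1"
    using \<sigma> by (simp_all add: mult)
  then have "invertible ?V" unfolding invertible_def by blast
  then have "?V ** matrix_inv ?V = mat 1" unfolding matrix_inv_def invertible_def by (rule someI2_ex) blast
  then have "\<sigma>\<^sup>2 *\<^sub>R matrix_inv ?V = mat 1" by (simp add: mult)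
  then have "(1 / \<sigma>\<^sup>2) *\<^sub>R \<sigma>\<^sup>2 *\<^sub>R matrix_inv ?V = (1 / \<sigma>\<^sup>2) *\<^sub>R mat 1" by simp
  then have inv: "matrix_inv ?V = (1 / \<sigma>\<^sup>2) *\<^sub>R mat 1" using \<sigma> by simp
  have det: "det ?V = (\<sigma>\<^sup>2) ^ CARD('d)"
    by (subst det_diagonal) (auto simp: mat_def)
  have quad: "x \<bullet> (matrix_inv ?V *v x) = (norm x)\<^sup>2 / \<sigma>\<^sup>2"
    by (simp add: inv scaleR_matrix_vector_assoc[symmetric] dot_square_norm)
  show 1: "mvnormal_density ?V x = exp (- (norm x)\<^sup>2 / (2 * \<sigma>\<^sup>2)) / sqrt ((2 * pi * \<sigma>\<^sup>2) ^ CARD('d))"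
    unfolding mvnormal_density_def det quad by (simp add: power_mult_distrib)
  have "(\<Prod>i\<in>UNIV. normal_density 0 \<sigma> (x $ i))
    = exp (\<Sum>i\<in>UNIV. - (x $ i)\<^sup>2 / (2 * \<sigma>\<^sup>2)) / sqrt (2 * pi * \<sigma>\<^sup>2) ^ CARD('d)"
    unfolding exp_sum[OF finite] by (simp add: normal_density_def prod_dividef)
  also have "(\<Sum>i\<in>UNIV. - (x $ i)\<^sup>2 / (2 * \<sigma>\<^sup>2)) = - (norm x)\<^sup>2 / (2 * \<sigma>\<^sup>2)"
    by (simp add: norm_vec_def L2_set_def sum_nonneg sum_divide_distrib[symmetric] sum_negf)
  finally show "mvnormal_density ?V x = (\<Prod>i\<in>UNIV. normal_density 0 \<sigma> (x $ i))"
    using 1 by (simp add: real_sqrt_power)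
qed

abbreviation iso_normal :: "real \<Rightarrow> (real^'d) measure" where
  "iso_normal \<sigma> \<equiv> mvnormal (\<sigma>\<^sup>2 *\<^sub>R mat 1)"

lemma sets_mvnormal[simp, measurable_cong]: "sets (mvnormal V) = sets borel"
  and space_mvnormal[simp]: "space (mvnormal V) = UNIV"
  by (simp_all add: mvnormal_def)

lemma nn_integral_iso_normal:
  fixes f :: "real^'d \<Rightarrow> ennreal"
  assumes "0 < \<sigma>" and [measurable]: "f \<in> borel_measurable borel"
  shows "(\<integral>\<^sup>+x. f x \<partial>iso_normal \<sigma>)
    = (\<integral>\<^sup>+x. ennreal (exp (- (norm x)\<^sup>2 / (2 * \<sigma>\<^sup>2)) / sqrt ((2 * pi * \<sigma>\<^sup>2) ^ CARD('d))) * f x \<partial>lborel)"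
  unfolding mvnormal_def mvnormal_density_isotropic(1)[OF assms(1)]
  by (rule nn_integral_density) auto

lemma nn_integral_iso_normal_orthogonal:
  fixes f :: "real^'d \<Rightarrow> ennreal" and R :: "real^'d \<Rightarrow> real^'d"
  assumes \<sigma>: "0 < \<sigma>" and [measurable]: "f \<in> borel_measurable borel" and R: "orthogonal_transformation R"
  shows "(\<integral>\<^sup>+x. f (R x) \<partial>iso_normal \<sigma>) = (\<integral>\<^sup>+x. f x \<partial>iso_normal \<sigma>)"
proof -
  note [measurable] = orthogonal_transformation_borel_measurable[OF R]
  let ?g = "\<lambda>x :: real^'d. ennreal (exp (- (norm x)\<^sup>2 / (2 * \<sigma>\<^sup>2)) / sqrt ((2 * pi * \<sigma>\<^sup>2) ^ CARD('d)))"
  have "(\<integral>\<^sup>+x. ?g x * f x \<partial>lborel) = (\<integral>\<^sup>+x. ?g x * f x \<partial>distr lborel borel R)"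
    by (simp add: distr_lborel_orthogonal_transformation[OF R])
  also have "\<dots> = (\<integral>\<^sup>+x. ?g x * f (R x) \<partial>lborel)"
    by (subst nn_integral_distr) (auto simp: orthogonal_transformation_norm[OF R])
  finally show ?thesis using \<sigma> by (simp add: nn_integral_iso_normal)
qed

text \<open>It suffices to compare the law of the coordinates with the product measure on boxes,
  where the density and the indicator factor together.\<close>

lemma iso_normal_eq_distr_PiM:
  assumes \<sigma>: "0 < \<sigma>"
  shows "(iso_normal \<sigma> :: (real^'d) measure) = distr (PiM UNIV (\<lambda>_::'d. normal \<sigma>)) borel (\<lambda>x. \<chi> i. x i)"
proof -
  interpret product_sigma_finite "\<lambda>_::'d. normal \<sigma>"
    by (rule product_sigma_finite_normal[OF \<sigma>])
  let ?M = "iso_normal \<sigma> :: (real^'d) measure" and ?P = "PiM UNIV (\<lambda>_::'d. normal \<sigma>)"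
  have meas[measurable]: "(\<lambda>x i. x $ i) \<in> measurable ?M ?P"
    by (rule measurable_PiM_single') auto
  have "distr ?M ?P (\<lambda>x i. x $ i) = ?P"
  proof (rule PiM_eqI)
    fix A :: "'d \<Rightarrow> real set" assume "\<And>i. i \<in> UNIV \<Longrightarrow> A i \<in> sets (normal \<sigma>)"
    then have [measurable]: "A i \<in> sets borel" for i by simp
    define f where "f i t = ennreal (normal_density 0 \<sigma> t) * indicator (A i) t" for i t
    have [measurable]: "f i \<in> borel_measurable borel" for i unfolding f_def by measurable
    \<comment> \<open>Integration of products over Lebesgue measure is phrased with
      \<open>Basis\<close>; this translates such products to the index type.\<close>
    have prod_Basis: "(\<Prod>b\<in>Basis. g (axis_index b) b) = (\<Prod>i\<in>UNIV. g i (axis i 1))"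
      for g :: "'d \<Rightarrow> real^'d \<Rightarrow> ennreal"
    proof -
      have B: "Basis = range (\<lambda>i::'d. axis i (1::real))" by (auto simp: Basis_vec_def)
      have inj: "inj (\<lambda>i::'d. axis i (1::real))" by (auto simp: inj_def axis_eq_axis)
      have "axis_index (axis i (1::real)) = i" for i :: 'd
        using axis_index[of "axis i (1::real)"] by (metis axis_eq_axis axis_in_Basis_iff axis_index_axis zero_neq_one)
      then show ?thesis unfolding B prod.reindex[OF inj] by simp
    qed
    have "emeasure (distr ?M ?P (\<lambda>x i. x $ i)) (Pi\<^sub>E UNIV A)
      = emeasure ?M {x. \<forall>i. x $ i \<in> A i}"
      by (subst emeasure_distr) (auto intro!: sets_PiM_I_finite arg_cong[where f="emeasure _"])
    also have "\<dots> = (\<integral>\<^sup>+x. ennreal (\<Prod>i\<in>UNIV. normal_density 0 \<sigma> (x $ i)) * indicator {x. \<forall>i. x $ i \<in> A i} x \<partial>lborel)"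
      unfolding mvnormal_def mvnormal_density_isotropic(2)[OF \<sigma>] by (rule emeasure_density) auto
    also have "\<dots> = (\<integral>\<^sup>+x. (\<Prod>b\<in>Basis. f (axis_index b) (x \<bullet> b)) \<partial>(lborel :: (real^'d) measure))"
    proof (rule nn_integral_cong)
      fix x :: "real^'d"
      have "ennreal (\<Prod>i\<in>UNIV. normal_density 0 \<sigma> (x $ i)) * indicator {x. \<forall>i. x $ i \<in> A i} x
        = (\<Prod>i\<in>UNIV. f i (x $ i))"
        by (auto simp: f_def prod.distrib prod_ennreal split: split_indicator)
      also have "\<dots> = (\<Prod>i\<in>UNIV. f i (x \<bullet> axis i 1))" by (simp add: inner_axis)
      finally show "ennreal (\<Prod>i\<in>UNIV. normal_density 0 \<sigma> (x $ i)) * indicator {x. \<forall>i. x $ i \<in> A i} x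
        = (\<Prod>b\<in>Basis. f (axis_index b) (x \<bullet> b))"
        using prod_Basis[of "\<lambda>i b. f i (x \<bullet> b)"] by simp
    qed
    also have "\<dots> = (\<Prod>b\<in>(Basis :: (real^'d) set). \<integral>\<^sup>+t. f (axis_index b) t \<partial>lborel)"
      by (rule nn_integral_lborel_prod) auto
    also have "\<dots> = (\<Prod>i\<in>UNIV. \<integral>\<^sup>+t. f i t \<partial>lborel)"
      by (rule prod_Basis)
    also have "\<dots> = (\<Prod>i\<in>UNIV. emeasure (normal \<sigma>) (A i))"
      by (simp add: f_def emeasure_density)
    finally show "emeasure (distr ?M ?P (\<lambda>x i. x $ i)) (Pi\<^sub>E UNIV A) = (\<Prod>i\<in>UNIV. emeasure (normal \<sigma>) (A i))" .
  qed auto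
  then have "distr ?P borel (\<lambda>x. \<chi> i. x i) = distr (distr ?M ?P (\<lambda>x i. x $ i)) borel (\<lambda>x. \<chi> i. x i)"
    by simp
  also have "\<dots> = distr ?M borel (\<lambda>x. x)"
    by (subst distr_distr) (auto simp: comp_def intro!: borel_measurable_vec_lambda)
  also have "\<dots> = ?M"
    using distr_id2[of borel ?M] by (simp add: id_def)
  finally show ?thesis ..
qed

lemma prob_space_iso_normal: "0 < \<sigma> \<Longrightarrow> prob_space (iso_normal \<sigma> :: (real^'d) measure)"
  unfolding iso_normal_eq_distr_PiM
  by (intro prob_space.prob_space_distr prob_space_PiM prob_space_normal_density borel_measurable_vec_lambda) auto

section \<open>Resampling one component of Gaussian vectors\<close>

text \<open>The component along \<open>e\<close> is independent of the orthogonal ones, so a fresh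
  copy of it leaves the law unchanged. For a coordinate axis this is Tonelli's theorem for the
  product; a rotation taking an axis to \<open>e\<close> gives the general case.\<close>

lemma nn_integral_iso_normal_resample:
  fixes h :: "real^'d \<Rightarrow> ennreal"
  assumes \<sigma>: "0 < \<sigma>" and [measurable]: "h \<in> borel_measurable borel" and e: "norm e = 1"
  shows "(\<integral>\<^sup>+y. \<integral>\<^sup>+t. h (y + (t - y \<bullet> e) *\<^sub>R e) \<partial>normal \<sigma> \<partial>iso_normal \<sigma>) = (\<integral>\<^sup>+y. h y \<partial>iso_normal \<sigma>)"
proof -
  interpret N: prob_space "normal \<sigma>" by (rule prob_space_normal_density[OF \<sigma>])
  interpret product_sigma_finite "\<lambda>_::'d. normal \<sigma>"
    by (rule product_sigma_finite_normal[OF \<sigma>])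
  have axis: "(\<integral>\<^sup>+y. \<integral>\<^sup>+t. h (y + (t - y \<bullet> axis j 1) *\<^sub>R axis j 1) \<partial>normal \<sigma> \<partial>iso_normal \<sigma>) = (\<integral>\<^sup>+y. h y \<partial>iso_normal \<sigma>)"
    if [measurable]: "h \<in> borel_measurable borel" for h :: "real^'d \<Rightarrow> ennreal" and j :: 'd
  proof -
    note [measurable] = borel_measurable_vec_lambda
    have ins: "insert j (UNIV - {j}) = UNIV" by auto
    have upd: "(\<chi> i. x i) + (t - (\<chi> i. x i) \<bullet> axis j 1) *\<^sub>R axis j 1 = (\<chi> i. (x(j := t)) i)" for x t
      by (auto simp: vec_eq_iff inner_axis) (auto simp: axis_def)
    have "(\<integral>\<^sup>+y. \<integral>\<^sup>+t. h (y + (t - y \<bullet> axis j 1) *\<^sub>R axis j 1) \<partial>normal \<sigma> \<partial>iso_normal \<sigma>)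
      = (\<integral>\<^sup>+x. \<integral>\<^sup>+t. h (\<chi> i. (x(j := t)) i) \<partial>normal \<sigma> \<partial>PiM (insert j (UNIV - {j})) (\<lambda>_. normal \<sigma>))"
      unfolding iso_normal_eq_distr_PiM[OF \<sigma>] ins
      by (subst nn_integral_distr) (auto simp: upd fun_upd_def)
    also have "\<dots> = (\<integral>\<^sup>+x. \<integral>\<^sup>+u. \<integral>\<^sup>+t. h (\<chi> i. ((x(j := u))(j := t)) i) \<partial>normal \<sigma> \<partial>normal \<sigma> \<partial>PiM (UNIV - {j}) (\<lambda>_. normal \<sigma>))"
      by (rule product_nn_integral_insert) (auto simp: ins)
    also have "\<dots> = (\<integral>\<^sup>+x. \<integral>\<^sup>+t. h (\<chi> i. (x(j := t)) i) \<partial>normal \<sigma> \<partial>PiM (UNIV - {j}) (\<lambda>_. normal \<sigma>))"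
      \<comment> \<open>The old value \<open>u\<close> is overwritten by \<open>t\<close>, so its
        integral only contributes the total mass 1.\<close>
      using N.emeasure_space_1 by simp
    also have "\<dots> = (\<integral>\<^sup>+x. h (\<chi> i. x i) \<partial>PiM (insert j (UNIV - {j})) (\<lambda>_. normal \<sigma>))"
      by (rule product_nn_integral_insert[symmetric]) auto
    also have "\<dots> = (\<integral>\<^sup>+y. h y \<partial>iso_normal \<sigma>)"
      unfolding iso_normal_eq_distr_PiM[OF \<sigma>] ins by (subst nn_integral_distr) auto
    finally show ?thesis .
  qed
  fix j :: 'd
  obtain R :: "real^'d \<Rightarrow> real^'d" where R: "orthogonal_transformation R" "R (axis j 1) = e"
    by (rule orthogonal_transformation_exists_1[OF _ e, of "axis j 1"]) auto
  note [measurable] = orthogonal_transformation_borel_measurable[OF R(1)]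
  have lin: "linear R" using R(1) by (rule orthogonal_transformation_linear)
  have "(\<integral>\<^sup>+y. \<integral>\<^sup>+t. h (y + (t - y \<bullet> e) *\<^sub>R e) \<partial>normal \<sigma> \<partial>iso_normal \<sigma>)
    = (\<integral>\<^sup>+y. \<integral>\<^sup>+t. h (R y + (t - R y \<bullet> e) *\<^sub>R e) \<partial>normal \<sigma> \<partial>iso_normal \<sigma>)"
    by (rule nn_integral_iso_normal_orthogonal[OF \<sigma> _ R(1), symmetric]) measurable
  also have "\<dots> = (\<integral>\<^sup>+y. \<integral>\<^sup>+t. h (R (y + (t - y \<bullet> axis j 1) *\<^sub>R axis j 1)) \<partial>normal \<sigma> \<partial>iso_normal \<sigma>)"
    using R by (simp add: orthogonal_transformation_def linear_add[OF lin] linear_cmul[OF lin] flip: R(2))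
  also have "\<dots> = (\<integral>\<^sup>+y. h (R y) \<partial>iso_normal \<sigma>)"
    by (rule axis) measurable
  also have "\<dots> = (\<integral>\<^sup>+y. h y \<partial>iso_normal \<sigma>)"
    by (rule nn_integral_iso_normal_orthogonal[OF \<sigma> _ R(1)]) measurable
  finally show ?thesis .
qed

text \<open>Resampling all members of an independent family at once. The resampled family has the
  original law because on boxes both iterated integrals factor over \<open>I\<close>, which leaves
  the one-member hypothesis for each index.\<close>

lemma nn_integral_PiM_resample:
  fixes T :: "'a \<Rightarrow> 'b \<Rightarrow> 'a"
  assumes "prob_space M" "prob_space N" and I: "finite I"
    and [measurable]: "(\<lambda>(y, t). T y t) \<in> measurable (M \<Otimes>\<^sub>M N) M"
    and resample: "\<And>h. h \<in> borel_measurable M \<Longrightarrow> (\<integral>\<^sup>+y. \<integral>\<^sup>+t. h (T y t) \<partial>N \<partial>M) = (\<integral>\<^sup>+y. h y \<partial>M)"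
    and [measurable]: "f \<in> borel_measurable (PiM I (\<lambda>_. M))"
  shows "(\<integral>\<^sup>+g. \<integral>\<^sup>+x. f (\<lambda>i\<in>I. T (g i) (x i)) \<partial>PiM I (\<lambda>_. N) \<partial>PiM I (\<lambda>_. M)) = (\<integral>\<^sup>+g. f g \<partial>PiM I (\<lambda>_. M))"
proof -
  interpret M: prob_space M by fact
  interpret N: prob_space N by fact
  interpret PM: product_sigma_finite "\<lambda>_. M" ..
  interpret PN: product_sigma_finite "\<lambda>_. N" ..
  interpret N': prob_space "PiM I (\<lambda>_. N)" by (rule prob_space_PiM) (rule assms(2))
  let ?P = "PiM I (\<lambda>_. M)" and ?Q = "PiM I (\<lambda>_. N)"
  let ?F = "\<lambda>(g, x). \<lambda>i\<in>I. T (g i) (x i)"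
  have [measurable]: "?F \<in> measurable (?P \<Otimes>\<^sub>M ?Q) ?P"
    unfolding split_beta' by (rule measurable_restrict) measurable
  have "distr (?P \<Otimes>\<^sub>M ?Q) ?P ?F = ?P"
  proof (rule PM.PiM_eqI[OF I])
    fix A assume A: "\<And>i. i \<in> I \<Longrightarrow> A i \<in> sets M"
    then have [measurable]: "i \<in> I \<Longrightarrow> A i \<in> sets M" for i .
    have "emeasure (distr (?P \<Otimes>\<^sub>M ?Q) ?P ?F) (Pi\<^sub>E I A)
      = (\<integral>\<^sup>+z. indicator (Pi\<^sub>E I A) (?F z) \<partial>(?P \<Otimes>\<^sub>M ?Q))"
    proof -
      have [measurable]: "Pi\<^sub>E I A \<in> sets ?P" using A I by (intro sets_PiM_I_finite) auto
      have "emeasure (distr (?P \<Otimes>\<^sub>M ?Q) ?P ?F) (Pi\<^sub>E I A)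
        = (\<integral>\<^sup>+z. indicator (Pi\<^sub>E I A) z \<partial>distr (?P \<Otimes>\<^sub>M ?Q) ?P ?F)"
        by simp
      also have "\<dots> = (\<integral>\<^sup>+z. indicator (Pi\<^sub>E I A) (?F z) \<partial>(?P \<Otimes>\<^sub>M ?Q))"
        by (rule nn_integral_distr) measurable
      finally show ?thesis .
    qed
    also have "\<dots> = (\<integral>\<^sup>+z. (\<Prod>i\<in>I. indicator (A i) (T (fst z i) (snd z i))) \<partial>(?P \<Otimes>\<^sub>M ?Q))"
      using I by (intro nn_integral_cong) (auto split: split_indicator simp: PiE_iff prod_eq_1_iff prod_zero_iff)
    also have "\<dots> = (\<integral>\<^sup>+g. \<integral>\<^sup>+x. (\<Prod>i\<in>I. indicator (A i) (T (g i) (x i))) \<partial>?Q \<partial>?P)"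
      by (subst N'.nn_integral_fst[symmetric]) auto
    also have "\<dots> = (\<integral>\<^sup>+g. (\<Prod>i\<in>I. \<integral>\<^sup>+t. indicator (A i) (T (g i) t) \<partial>N) \<partial>?P)"
      using I by (intro nn_integral_cong PN.product_nn_integral_prod) (auto simp: space_PiM PiE_iff)
    also have "\<dots> = (\<Prod>i\<in>I. \<integral>\<^sup>+y. \<integral>\<^sup>+t. indicator (A i) (T y t) \<partial>N \<partial>M)"
      using I by (intro PM.product_nn_integral_prod) auto
    also have "\<dots> = (\<Prod>i\<in>I. emeasure M (A i))"
      using A by (intro prod.cong refl) (subst resample; simp)
    finally show "emeasure (distr (?P \<Otimes>\<^sub>M ?Q) ?P ?F) (Pi\<^sub>E I A) = (\<Prod>i\<in>I. emeasure M (A i))" .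
  qed simp
  then have "(\<integral>\<^sup>+g. f g \<partial>?P) = (\<integral>\<^sup>+g. f g \<partial>distr (?P \<Otimes>\<^sub>M ?Q) ?P ?F)" by simp
  also have "\<dots> = (\<integral>\<^sup>+z. f (?F z) \<partial>(?P \<Otimes>\<^sub>M ?Q))"
    by (rule nn_integral_distr) measurable
  also have "\<dots> = (\<integral>\<^sup>+g. \<integral>\<^sup>+x. f (\<lambda>i\<in>I. T (g i) (x i)) \<partial>?Q \<partial>?P)"
    by (subst N'.nn_integral_fst[symmetric]) auto
  finally show ?thesis ..
qed

section \<open>Givens rotations of Gaussian vectors\<close>

text \<open>Vectors are functions on a set of naturals because the number of samples is a variable,
  not a type. Inner products are preserved for all functions, not just points of the product space:
  the map is applied to coefficient vectors as well as to samples.\<close>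

definition gaussian_isometry :: "real \<Rightarrow> nat set \<Rightarrow> ((nat \<Rightarrow> real) \<Rightarrow> (nat \<Rightarrow> real)) \<Rightarrow> bool" where
  "gaussian_isometry \<sigma> I U \<longleftrightarrow>
     U \<in> measurable (PiM I (\<lambda>_. normal \<sigma>)) (PiM I (\<lambda>_. normal \<sigma>)) \<and>
     distr (PiM I (\<lambda>_. normal \<sigma>)) (PiM I (\<lambda>_. normal \<sigma>)) U = PiM I (\<lambda>_. normal \<sigma>) \<and>
     (\<forall>x y. (\<Sum>i\<in>I. U x i * U y i) = (\<Sum>i\<in>I. x i * y i))"

lemma gaussian_isometry_id: "gaussian_isometry \<sigma> I (\<lambda>x. x)"
  by (simp add: gaussian_isometry_def)

lemma gaussian_isometry_comp:
  assumes "gaussian_isometry \<sigma> I U" "gaussian_isometry \<sigma> I V"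
  shows "gaussian_isometry \<sigma> I (\<lambda>x. V (U x))"
proof -
  let ?P = "PiM I (\<lambda>_. normal \<sigma>)"
  have [measurable]: "U \<in> measurable ?P ?P" "V \<in> measurable ?P ?P"
    using assms by (simp_all add: gaussian_isometry_def)
  have "distr ?P ?P (\<lambda>x. V (U x)) = distr (distr ?P ?P U) ?P V"
    by (subst distr_distr) (auto simp: comp_def)
  then show ?thesis using assms by (simp add: gaussian_isometry_def)
qed

definition givens :: "nat \<Rightarrow> nat \<Rightarrow> real \<Rightarrow> real \<Rightarrow> (nat \<Rightarrow> real) \<Rightarrow> nat \<Rightarrow> real" where
  "givens i j c s x = x(i := c * x i + s * x j, j := c * x j - s * x i)"

text \<open>With the other coordinates held fixed, this is a planar rotation acting on two
  independent Gaussians.\<close>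

lemma gaussian_isometry_givens:
  assumes \<sigma>: "0 < \<sigma>" and I: "finite I" "i \<in> I" "j \<in> I" "i \<noteq> j" and cs: "c\<^sup>2 + s\<^sup>2 = 1"
  shows "gaussian_isometry \<sigma> I (givens i j c s)"
proof -
  interpret product_sigma_finite "\<lambda>_::nat. normal \<sigma>"
    by (rule product_sigma_finite_normal[OF \<sigma>])
  let ?P = "\<lambda>I::nat set. PiM I (\<lambda>_. normal \<sigma>)"
  define J where "J = I - {i, j}"
  have J: "I = insert i (insert j J)" "finite J" "i \<notin> insert j J" "j \<notin> J"
    using I by (auto simp: J_def)
  have [measurable]: "givens i j c s \<in> measurable (?P I) (?P I)"
    unfolding givens_def using I by (intro measurable_fun_upd[where J=I]) auto
  \<comment> \<open>The pair is ordered with coordinate \<open>j\<close> first, matching the order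
    of integration in \<open>split\<close> below.\<close>
  define R :: "real \<times> real \<Rightarrow> real \<times> real" where
    "R = (\<lambda>(b, a). (c * b - s * a, s * b + c * a))"
  have R: "orthogonal_transformation R"
  proof -
    have "linear R"
      by (rule linearI) (auto simp: R_def algebra_simps)
    moreover have "R v \<bullet> R w = v \<bullet> w" for v w
    proof -
      have "R v \<bullet> R w = (c\<^sup>2 + s\<^sup>2) * (v \<bullet> w)"
        by (simp add: R_def inner_prod_def split_beta algebra_simps power2_eq_square)
      then show ?thesis using cs by simp
    qed
    ultimately show ?thesis by (simp add: orthogonal_transformation_def)
  qed
  have split: "(\<integral>\<^sup>+x. F x \<partial>?P I) = (\<integral>\<^sup>+x. \<integral>\<^sup>+b. \<integral>\<^sup>+a. F (x(j := b, i := a)) \<partial>normal \<sigma> \<partial>normal \<sigma> \<partial>?P J)"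
    if "F \<in> borel_measurable (?P I)" for F
  proof -
    have [measurable]: "F \<in> borel_measurable (?P (insert i (insert j J)))"
      using that J(1) by simp
    have "(\<integral>\<^sup>+x. F x \<partial>?P I) = (\<integral>\<^sup>+y. \<integral>\<^sup>+a. F (y(i := a)) \<partial>normal \<sigma> \<partial>?P (insert j J))"
      unfolding J(1) using J by (intro product_nn_integral_insert) auto
    also have "\<dots> = (\<integral>\<^sup>+x. \<integral>\<^sup>+b. \<integral>\<^sup>+a. F (x(j := b, i := a)) \<partial>normal \<sigma> \<partial>normal \<sigma> \<partial>?P J)"
      using J by (intro product_nn_integral_insert) auto
    finally show ?thesis .
  qed
  have "distr (?P I) (?P I) (givens i j c s) = ?P I"
  proof (rule measure_eqI)
    fix A assume "A \<in> sets (distr (?P I) (?P I) (givens i j c s))"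
    then have A[measurable]: "A \<in> sets (?P I)" by simp
    have "emeasure (distr (?P I) (?P I) (givens i j c s)) A
      = (\<integral>\<^sup>+x. indicator A x \<partial>distr (?P I) (?P I) (givens i j c s))"
      by simp
    also have "\<dots> = (\<integral>\<^sup>+x. indicator A (givens i j c s x) \<partial>?P I)"
      by (rule nn_integral_distr) measurable
    also have "\<dots> = (\<integral>\<^sup>+x. \<integral>\<^sup>+b. \<integral>\<^sup>+a. indicator A (givens i j c s (x(j := b, i := a))) \<partial>normal \<sigma> \<partial>normal \<sigma> \<partial>?P J)"
      by (rule split) measurable
    also have "\<dots> = (\<integral>\<^sup>+x. \<integral>\<^sup>+b. \<integral>\<^sup>+a. indicator A (x(j := b, i := a)) \<partial>normal \<sigma> \<partial>normal \<sigma> \<partial>?P J)"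
    proof (rule nn_integral_cong)
      fix x assume x: "x \<in> space (?P J)"
      define f :: "real \<times> real \<Rightarrow> ennreal" where "f = (\<lambda>z. indicator A (x(j := fst z, i := snd z)))"
      have "(\<lambda>z. x(j := fst z, i := snd z)) \<in> measurable (borel \<Otimes>\<^sub>M borel) (?P I)"
      proof (rule measurable_fun_upd[where J="insert j J"])
        show "(\<lambda>z. x(j := fst z)) \<in> measurable (borel \<Otimes>\<^sub>M borel) (?P (insert j J))"
          by (rule measurable_fun_upd[where J=J]) (use x in auto)
      qed (use J in auto)
      then have [measurable]: "f \<in> borel_measurable borel"
        unfolding f_def borel_prod[symmetric] by measurable
      have "indicator A (givens i j c s (x(j := b, i := a))) = f (R (b, a))" for a b
        using J by (simp add: givens_def f_def R_def fun_upd_twist add.commute)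
      then show "(\<integral>\<^sup>+b. \<integral>\<^sup>+a. indicator A (givens i j c s (x(j := b, i := a))) \<partial>normal \<sigma> \<partial>normal \<sigma>)
        = (\<integral>\<^sup>+b. \<integral>\<^sup>+a. indicator A (x(j := b, i := a)) \<partial>normal \<sigma> \<partial>normal \<sigma>)"
        using nn_integral_normal_pair_orthogonal[OF \<open>f \<in> borel_measurable borel\<close> \<sigma> R] by (simp add: f_def)
    qed
    also have "\<dots> = (\<integral>\<^sup>+x. indicator A x \<partial>?P I)"
      by (rule split[symmetric]) measurable
    finally show "emeasure (distr (?P I) (?P I) (givens i j c s)) A = emeasure (?P I) A"
      by simp
  qed simp
  moreover have "(\<Sum>l\<in>I. givens i j c s x l * givens i j c s y l) = (\<Sum>l\<in>I. x l * y l)" for x y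
  proof -
    have "(\<Sum>l\<in>J. givens i j c s x l * givens i j c s y l) = (\<Sum>l\<in>J. x l * y l)"
      using J by (intro sum.cong) (auto simp: givens_def)
    moreover have "(c * x i + s * x j) * (c * y i + s * y j) + (c * x j - s * x i) * (c * y j - s * y i)
      = (c\<^sup>2 + s\<^sup>2) * (x i * y i + x j * y j)"
      by (simp add: algebra_simps power2_eq_square)
    ultimately show ?thesis
      using J cs by (simp add: givens_def)
  qed
  ultimately show ?thesis by (simp add: gaussian_isometry_def)
qed

lemma givens_annihilates:
  obtains c s :: real where "c\<^sup>2 + s\<^sup>2 = 1" "\<And>i j. x i = u \<Longrightarrow> x j = v \<Longrightarrow> givens i j c s x j = 0"
proof (cases "u\<^sup>2 + v\<^sup>2 = 0")
  case True
  then show ?thesis using that[of 1 0] by (auto simp: givens_def sum_power2_eq_zero_iff)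
next
  case False
  define r where "r = sqrt (u\<^sup>2 + v\<^sup>2)"
  have r: "r\<^sup>2 = u\<^sup>2 + v\<^sup>2" "r \<noteq> 0" using False by (simp_all add: r_def)
  show ?thesis
  proof (rule that)
    show "(u / r)\<^sup>2 + (v / r)\<^sup>2 = 1"
      using r False by (simp add: power_divide add_divide_distrib[symmetric])
  qed (auto simp: givens_def)
qed

text \<open>One column of a QR decomposition: rotating coordinate \<open>r\<close> against each
  later one in turn collects their mass in coordinate \<open>r\<close>. Only coordinates from
  \<open>r\<close> on are mixed, so vectors already vanishing there keep their zeros.\<close>

lemma ex_gaussian_isometry_annihilates_tail:
  assumes \<sigma>: "0 < \<sigma>" and "r + n < k"
  shows "\<exists>U. gaussian_isometry \<sigma> {..<k} U \<and> (\<forall>i. r < i \<and> i \<le> r + n \<longrightarrow> U w i = 0) \<and>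
    (\<forall>y. (\<forall>i\<in>{r..<k}. y i = 0) \<longrightarrow> (\<forall>i\<in>{r..<k}. U y i = 0))"
  using assms(2)
proof (induction n)
  case 0
  show ?case by (rule exI[of _ "\<lambda>x. x"]) (auto simp: gaussian_isometry_id)
next
  case (Suc n)
  then obtain U where U: "gaussian_isometry \<sigma> {..<k} U" "\<And>i. r < i \<Longrightarrow> i \<le> r + n \<Longrightarrow> U w i = 0"
    "\<And>y. \<forall>i\<in>{r..<k}. y i = 0 \<Longrightarrow> \<forall>i\<in>{r..<k}. U y i = 0" by auto
  let ?j = "r + Suc n"
  obtain c s :: real where cs: "c\<^sup>2 + s\<^sup>2 = 1" "givens r ?j c s (U w) ?j = 0"
    using givens_annihilates[of "U w" "U w r" "U w ?j"] by metis
  let ?U = "\<lambda>x. givens r ?j c s (U x)"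
  have "gaussian_isometry \<sigma> {..<k} ?U"
    using Suc.prems cs by (intro gaussian_isometry_comp[OF U(1)] gaussian_isometry_givens[OF \<sigma>]) auto
  moreover have "?U w i = 0" if "r < i" "i \<le> r + Suc n" for i
  proof (cases "i = ?j")
    case False
    then have "?U w i = U w i" using that by (simp add: givens_def)
    then show ?thesis using U(2)[of i] that False by auto
  qed (use cs(2) in simp)
  moreover have "\<forall>i\<in>{r..<k}. ?U y i = 0" if "\<forall>i\<in>{r..<k}. y i = 0" for y
    using U(3)[OF that] Suc.prems by (auto simp: givens_def)
  ultimately show ?case by blast
qed

text \<open>QR decomposition by induction over the vectors. The pivot for a new vector is coordinate
  \<open>card C\<close>, the first one at which the images of the earlier vectors are all guaranteed
  to vanish.\<close>

lemma ex_gaussian_isometry_annihilates: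
  assumes \<sigma>: "0 < \<sigma>" and "finite C" "card C \<le> k"
  shows "\<exists>U. gaussian_isometry \<sigma> {..<k} U \<and> (\<forall>y\<in>C. \<forall>i\<in>{card C..<k}. U y i = 0)"
  using assms(2,3)
proof (induction C rule: finite_induct)
  case empty
  show ?case by (rule exI[of _ "\<lambda>x. x"]) (auto simp: gaussian_isometry_id)
next
  case (insert w C)
  then obtain U where U: "gaussian_isometry \<sigma> {..<k} U" "\<And>y. y \<in> C \<Longrightarrow> \<forall>i\<in>{card C..<k}. U y i = 0"
    by auto
  have "card C + (k - Suc (card C)) < k" using insert by auto
  from ex_gaussian_isometry_annihilates_tail[OF \<sigma> this, of "U w"]
  obtain V where V: "gaussian_isometry \<sigma> {..<k} V"
    "\<And>i. card C < i \<Longrightarrow> i \<le> card C + (k - Suc (card C)) \<Longrightarrow> V (U w) i = 0"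
    "\<And>y. \<forall>i\<in>{card C..<k}. y i = 0 \<Longrightarrow> \<forall>i\<in>{card C..<k}. V y i = 0" by auto
  show ?case
  proof (intro exI conjI ballI)
    show "gaussian_isometry \<sigma> {..<k} (\<lambda>x. V (U x))" by (rule gaussian_isometry_comp[OF U(1) V(1)])
    fix y i assume y: "y \<in> insert w C" and i: "i \<in> {card (insert w C)..<k}"
    then have i: "card C < i" "i < k" using insert by auto
    show "V (U y) i = 0"
    proof (cases "y = w")
      case True
      then show ?thesis using V(2)[of i] i by auto
    next
      case False
      then have "\<forall>i\<in>{card C..<k}. U y i = 0" using U(2) y by auto
      from V(3)[OF this] show ?thesis using i by auto
    qed
  qed
qed

section \<open>Wishart matrices and differential privacy\<close>

text \<open>Rotate the coordinates so that \<^term>\<open>\<Sum>i<k. x i *\<^sub>R v i\<close> depends on the first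
  \<^term>\<open>CARD('d)\<close> of them only. Conditionally on all but the last \<^term>\<open>2 * Suc n\<close> coordinates, the
  pair is then a function of the Erlang distributed sum of the squares of these last ones.\<close>

lemma nn_integral_gaussian_shift_le:
  fixes v :: "nat \<Rightarrow> real^'d" and A :: "(real \<times> (real^'d)) set"
  assumes \<sigma>: "0 < \<sigma>" and A: "A \<in> sets borel" and k: "CARD('d) + 2 * Suc n \<le> k"
    and shift: "\<And>T. T \<in> sets borel \<Longrightarrow>
      (\<integral>\<^sup>+t. indicator T (t + s1) \<partial>density lborel (erlang_density n (1 / (2 * \<sigma>\<^sup>2))))
        \<le> K * (\<integral>\<^sup>+t. indicator T (t + s2) \<partial>density lborel (erlang_density n (1 / (2 * \<sigma>\<^sup>2)))) + D"
  shows "(\<integral>\<^sup>+x. indicator A ((\<Sum>i<k. (x i)\<^sup>2) + s1, \<Sum>i<k. x i *\<^sub>R v i) \<partial>PiM {..<k} (\<lambda>_. normal \<sigma>))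
    \<le> K * (\<integral>\<^sup>+x. indicator A ((\<Sum>i<k. (x i)\<^sup>2) + s2, \<Sum>i<k. x i *\<^sub>R v i) \<partial>PiM {..<k} (\<lambda>_. normal \<sigma>)) + D"
proof -
  interpret product_sigma_finite "\<lambda>_::nat. normal \<sigma>"
    by (rule product_sigma_finite_normal[OF \<sigma>])
  let ?P = "\<lambda>I::nat set. PiM I (\<lambda>_. normal \<sigma>)"
  let ?E = "density lborel (erlang_density n (1 / (2 * \<sigma>\<^sup>2)))"
  have [measurable]: "A \<in> sets (borel \<Otimes>\<^sub>M borel)" using A by (simp flip: borel_prod)
  interpret E: prob_space ?E using \<sigma> by (intro prob_space_erlang_density) simp
  \<comment> \<open>The \<open>j\<close>-th entry of \<open>\<Sum>i<k. x i *\<^sub>R v i\<close> is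
    the inner product of \<open>x\<close> with \<open>c j\<close>, so these at most
    \<open>CARD('d)\<close> vectors are the ones to be rotated.\<close>
  define c where "c j i = v i $ j" for j i
  \<comment> \<open>A surplus coordinate beyond \<open>CARD('d)\<close> is conditioned on together
    with the first ones, so that exactly \<open>2 * Suc n\<close> remain.\<close>
  define m where "m = k - 2 * Suc n"
  have m: "CARD('d) \<le> m" "m \<le> k" "card {m..<k} = 2 * Suc n" using k by (auto simp: m_def)
  have cC: "card (range c) \<le> CARD('d)" by (rule card_image_le) simp
  obtain U where U: "gaussian_isometry \<sigma> {..<k} U" "\<And>j i. i \<in> {card (range c)..<k} \<Longrightarrow> U (c j) i = 0"
    using ex_gaussian_isometry_annihilates[OF \<sigma>, of "range c" k] cC m by auto
  have [measurable]: "U \<in> measurable (?P {..<k}) (?P {..<k})"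
    and U_distr: "distr (?P {..<k}) (?P {..<k}) U = ?P {..<k}"
    and U_inner: "\<And>x y. (\<Sum>i<k. U x i * U y i) = (\<Sum>i<k. x i * y i)"
    using U(1) by (simp_all add: gaussian_isometry_def)
  define w :: "(nat \<Rightarrow> real) \<Rightarrow> real^'d" where "w y = (\<chi> j. \<Sum>i<m. y i * U (c j) i)" for y
  have w: "w \<in> borel_measurable (?P J)" if "{..<m} \<subseteq> J" for J
    unfolding w_def using that
    by (intro borel_measurable_vec_lambda borel_measurable_sum borel_measurable_times) auto
  have w': "w \<in> borel_measurable (?P {..<m})" "w \<in> borel_measurable (?P {..<k})"
    using m by (auto intro!: w)
  note [measurable] = w'
  have sq: "(\<Sum>i<k. (x i)\<^sup>2) = (\<Sum>i<k. (U x i)\<^sup>2)" for x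
    using U_inner[of x x] by (simp add: power2_eq_square)
  have lin: "(\<Sum>i<k. x i *\<^sub>R v i) = w (U x)" for x
  proof -
    have "(\<Sum>i<k. x i * v i $ j) = (\<Sum>i<m. U x i * U (c j) i)" for j
    proof -
      have "(\<Sum>i<k. x i * v i $ j) = (\<Sum>i<k. U x i * U (c j) i)"
        using U_inner[of x "c j"] by (simp add: c_def)
      also have "\<dots> = (\<Sum>i<m. U x i * U (c j) i)"
        using m cC U(2) by (intro sum.mono_neutral_right) auto
      finally show ?thesis .
    qed
    then show ?thesis by (simp add: vec_eq_iff w_def)
  qed
  define G where "G y s = (\<integral>\<^sup>+t. indicator A ((\<Sum>i<m. (y i)\<^sup>2) + t + s, w y) \<partial>?E)" for y s
  have [measurable]: "(\<lambda>y. G y s) \<in> borel_measurable (?P {..<m})" for s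
    unfolding G_def by measurable
  have eq: "(\<integral>\<^sup>+x. indicator A ((\<Sum>i<k. (x i)\<^sup>2) + s, \<Sum>i<k. x i *\<^sub>R v i) \<partial>?P {..<k})
    = (\<integral>\<^sup>+y. G y s \<partial>?P {..<m})" for s
  proof -
    let ?f = "\<lambda>y. indicator A ((\<Sum>i<k. (y i)\<^sup>2) + s, w y) :: ennreal"
    have un: "{..<m} \<union> {m..<k} = {..<k}" using m by auto
    have f: "?f \<in> borel_measurable (?P {..<k})" by measurable
    have "(\<integral>\<^sup>+x. indicator A ((\<Sum>i<k. (x i)\<^sup>2) + s, \<Sum>i<k. x i *\<^sub>R v i) \<partial>?P {..<k})
      = (\<integral>\<^sup>+x. ?f (U x) \<partial>?P {..<k})"
      by (simp only: sq[symmetric] lin)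
    also have "\<dots> = (\<integral>\<^sup>+y. ?f y \<partial>distr (?P {..<k}) (?P {..<k}) U)"
      using nn_integral_distr[OF \<open>U \<in> measurable (?P {..<k}) (?P {..<k})\<close>, of ?f] f by simp
    also have "\<dots> = (\<integral>\<^sup>+y. ?f y \<partial>?P ({..<m} \<union> {m..<k}))"
      unfolding U_distr un ..
    also have "\<dots> = (\<integral>\<^sup>+y. \<integral>\<^sup>+z. ?f (merge {..<m} {m..<k} (y, z)) \<partial>?P {m..<k} \<partial>?P {..<m})"
      using product_nn_integral_fold[of "{..<m}" "{m..<k}" ?f] f unfolding un by (simp add: ivl_disj_int)
    also have "\<dots> = (\<integral>\<^sup>+y. G y s \<partial>?P {..<m})"
    proof (rule nn_integral_cong)
      fix y assume "y \<in> space (?P {..<m})"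
      have "(\<Sum>i<k. (merge {..<m} {m..<k} (y, z) i)\<^sup>2) = (\<Sum>i<m. (y i)\<^sup>2) + (\<Sum>i\<in>{m..<k}. (z i)\<^sup>2)" for z :: "nat \<Rightarrow> real"
      proof -
        have "(\<Sum>i<k. (merge {..<m} {m..<k} (y, z) i)\<^sup>2)
          = (\<Sum>i\<in>{..<m}. (merge {..<m} {m..<k} (y, z) i)\<^sup>2) + (\<Sum>i\<in>{m..<k}. (merge {..<m} {m..<k} (y, z) i)\<^sup>2)"
          unfolding un[symmetric] by (rule sum.union_disjoint) auto
        then show ?thesis by (simp add: merge_def)
      qed
      moreover have "w (merge {..<m} {m..<k} (y, z)) = w y" for z
        by (simp add: w_def merge_def)
      ultimately have "(\<integral>\<^sup>+z. ?f (merge {..<m} {m..<k} (y, z)) \<partial>?P {m..<k})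
        = (\<integral>\<^sup>+z. indicator A ((\<Sum>i<m. (y i)\<^sup>2) + (\<Sum>i\<in>{m..<k}. (z i)\<^sup>2) + s, w y) \<partial>?P {m..<k})"
        by simp
      also have "\<dots> = G y s"
        unfolding G_def
        by (rule nn_integral_normal_sum_squares[OF \<sigma> _ m(3), where f="\<lambda>t. indicator A ((\<Sum>i<m. (y i)\<^sup>2) + t + s, w y)"])
          measurable
      finally show "(\<integral>\<^sup>+z. ?f (merge {..<m} {m..<k} (y, z)) \<partial>?P {m..<k}) = G y s" .
    qed
    finally show ?thesis .
  qed
  have "G y s1 \<le> K * G y s2 + D" for y
  proof -
    \<comment> \<open>Given the first \<open>m\<close> coordinates, the event is a Borel set of
      values of the remaining sum of squares, and the shift acts on that sum alone.\<close>
    let ?T = "{t. ((\<Sum>i<m. (y i)\<^sup>2) + t, w y) \<in> A}"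
    have T: "?T \<in> sets borel" by measurable
    have "indicator ?T (t + s) = (indicator A ((\<Sum>i<m. (y i)\<^sup>2) + t + s, w y) :: ennreal)" for t s
      by (simp add: indicator_def add.assoc)
    then show ?thesis using shift[OF T] unfolding G_def by simp
  qed
  then have "(\<integral>\<^sup>+y. G y s1 \<partial>?P {..<m}) \<le> (\<integral>\<^sup>+y. K * G y s2 + D \<partial>?P {..<m})"
    by (intro nn_integral_mono)
  also have "\<dots> = K * (\<integral>\<^sup>+y. G y s2 \<partial>?P {..<m}) + D"
  proof -
    interpret Pm: prob_space "?P {..<m}" by (intro prob_space_PiM prob_space_normal_density \<sigma>)
    show ?thesis using Pm.emeasure_space_1 by (simp add: nn_integral_add nn_integral_cmult)
  qed
  finally show ?thesis unfolding eq .
qed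

text \<open>The cross terms are written with \<open>x *\<^sub>R v\<close> so that, summed over the
  samples, they depend only on the sum of these products.\<close>

lemma outer_add_scaleR: "outer (v + x *\<^sub>R e) = outer v + (\<chi> p q. (x *\<^sub>R v) $ p * e $ q + e $ p * (x *\<^sub>R v) $ q) + x\<^sup>2 *\<^sub>R outer e"
  by (simp add: vec_eq_iff outer_def algebra_simps power2_eq_square)

lemma outer_scaleR: "outer (x *\<^sub>R e) = x\<^sup>2 *\<^sub>R outer e"
  by (simp add: vec_eq_iff outer_def power2_eq_square)

lemma borel_measurable_outer[measurable]: "outer \<in> borel_measurable borel"
  unfolding outer_def
  by (intro borel_measurable_continuous_onI continuous_intros)

lemma nn_integral_wishart_shift_le:
  fixes e :: "real^'d"
  assumes \<sigma>: "0 < \<sigma>" and S: "S \<in> sets borel" and k: "CARD('d) + 2 * Suc n \<le> k" and e: "norm e = 1"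
    and shift: "\<And>T. T \<in> sets borel \<Longrightarrow>
      (\<integral>\<^sup>+t. indicator T (t + s1) \<partial>density lborel (erlang_density n (1 / (2 * \<sigma>\<^sup>2))))
        \<le> K * (\<integral>\<^sup>+t. indicator T (t + s2) \<partial>density lborel (erlang_density n (1 / (2 * \<sigma>\<^sup>2)))) + D"
  shows "(\<integral>\<^sup>+N. indicator S (N + s1 *\<^sub>R outer e) \<partial>wishart (\<sigma>\<^sup>2 *\<^sub>R mat 1) k)
    \<le> K * (\<integral>\<^sup>+N. indicator S (N + s2 *\<^sub>R outer e) \<partial>wishart (\<sigma>\<^sup>2 *\<^sub>R mat 1) k) + D"
proof -
  note [measurable] = S
  interpret P: prob_space "PiM {..<k} (\<lambda>_. iso_normal \<sigma> :: (real^'d) measure)"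
    by (intro prob_space_PiM) (rule prob_space_iso_normal[OF \<sigma>])
  interpret N: prob_space "PiM {..<k} (\<lambda>_. normal \<sigma>)"
    by (intro prob_space_PiM prob_space_normal_density \<sigma>)
  let ?P = "PiM {..<k} (\<lambda>_. iso_normal \<sigma> :: (real^'d) measure)" and ?N = "PiM {..<k} (\<lambda>_. normal \<sigma>)"
  \<comment> \<open>This is the conditional probability of the event given the samples
    \<open>g\<close>, after their components along \<open>e\<close> have been replaced by fresh ones
    \<open>x\<close>.\<close>
  define H where "H g s = (\<integral>\<^sup>+x. indicator S ((\<Sum>i<k. outer (g i + (x i - g i \<bullet> e) *\<^sub>R e)) + s *\<^sub>R outer e) \<partial>?N)"
    for g s
  have [measurable]: "(\<lambda>g. H g s) \<in> borel_measurable ?P" for s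
    unfolding H_def by measurable
  have eq: "(\<integral>\<^sup>+N. indicator S (N + s *\<^sub>R outer e) \<partial>wishart (\<sigma>\<^sup>2 *\<^sub>R mat 1) k) = (\<integral>\<^sup>+g. H g s \<partial>?P)" for s
  proof -
    let ?f = "\<lambda>g. indicator S ((\<Sum>i<k. outer (g i)) + s *\<^sub>R outer e) :: ennreal"
    have "(\<integral>\<^sup>+N. indicator S (N + s *\<^sub>R outer e) \<partial>wishart (\<sigma>\<^sup>2 *\<^sub>R mat 1) k) = (\<integral>\<^sup>+g. ?f g \<partial>?P)"
      unfolding wishart_def by (rule nn_integral_distr) measurable
    also have "\<dots> = (\<integral>\<^sup>+g. \<integral>\<^sup>+x. ?f (\<lambda>i\<in>{..<k}. g i + (x i - g i \<bullet> e) *\<^sub>R e) \<partial>?N \<partial>?P)"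
    proof (rule nn_integral_PiM_resample[symmetric])
      show "(\<integral>\<^sup>+y. \<integral>\<^sup>+t. h (y + (t - y \<bullet> e) *\<^sub>R e) \<partial>normal \<sigma> \<partial>iso_normal \<sigma>) = (\<integral>\<^sup>+y. h y \<partial>iso_normal \<sigma>)"
        if "h \<in> borel_measurable (iso_normal \<sigma>)" for h :: "real^'d \<Rightarrow> ennreal"
        using that by (intro nn_integral_iso_normal_resample \<sigma> e) (simp cong: measurable_cong_sets)
    qed (use \<sigma> in \<open>auto intro!: prob_space_iso_normal prob_space_normal_density\<close>)
    also have "\<dots> = (\<integral>\<^sup>+g. H g s \<partial>?P)"
      by (simp add: H_def)
    finally show ?thesis .
  qed
  have "H g s1 \<le> K * H g s2 + D" for g
  proof -
    define v where "v i = g i - (g i \<bullet> e) *\<^sub>R e" for i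
    \<comment> \<open>With the orthogonal parts \<open>v\<close> fixed, \<open>\<Phi>\<close>
      rebuilds the matrix from the two statistics of \<open>x\<close>; adding a multiple of
      \<open>outer e\<close> shifts just the first statistic.\<close>
    define \<Phi> :: "real \<times> (real^'d) \<Rightarrow> real^'d^'d" where
      "\<Phi> z = (\<Sum>i<k. outer (v i)) + (\<chi> p q. snd z $ p * e $ q + e $ p * snd z $ q) + fst z *\<^sub>R outer e" for z
    have [measurable]: "\<Phi> \<in> borel_measurable borel"
      unfolding \<Phi>_def by (intro borel_measurable_continuous_onI continuous_intros)
    have "(\<Sum>i<k. outer (g i + (x i - g i \<bullet> e) *\<^sub>R e)) + s *\<^sub>R outer e
      = \<Phi> ((\<Sum>i<k. (x i)\<^sup>2) + s, \<Sum>i<k. x i *\<^sub>R v i)" for x s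
    proof -
      have "outer (g i + (x i - g i \<bullet> e) *\<^sub>R e) = outer (v i + x i *\<^sub>R e)" for i
        by (simp add: v_def algebra_simps)
      then show ?thesis
        by (simp add: \<Phi>_def outer_add_scaleR sum.distrib scaleR_add_left scaleR_sum_left)
          (simp add: vec_eq_iff sum.distrib sum_distrib_left sum_distrib_right)
    qed
    then have H: "H g s = (\<integral>\<^sup>+x. indicator (\<Phi> -` S) ((\<Sum>i<k. (x i)\<^sup>2) + s, \<Sum>i<k. x i *\<^sub>R v i) \<partial>?N)" for s
      unfolding H_def by (simp add: indicator_def)
    have "\<Phi> -` S \<in> sets borel"
      using measurable_sets_borel[of \<Phi> borel S] by simp
    then show ?thesis
      unfolding H by (rule nn_integral_gaussian_shift_le[OF \<sigma> _ k shift])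
  qed
  then have "(\<integral>\<^sup>+g. H g s1 \<partial>?P) \<le> (\<integral>\<^sup>+g. K * H g s2 + D \<partial>?P)"
    by (intro nn_integral_mono)
  also have "\<dots> = K * (\<integral>\<^sup>+g. H g s2 \<partial>?P) + D"
    using P.emeasure_space_1 by (simp add: nn_integral_add nn_integral_cmult)
  finally show ?thesis unfolding eq .
qed

lemma prob_space_wishart: "0 < \<sigma> \<Longrightarrow> prob_space (wishart (\<sigma>\<^sup>2 *\<^sub>R mat 1 :: real^'d^'d) k)"
  unfolding wishart_def
  by (intro prob_space.prob_space_distr prob_space_PiM prob_space_iso_normal) (auto intro!: borel_measurable_sum)

lemma sets_wishart[simp, measurable_cong]: "sets (wishart V k) = sets borel"
  and space_wishart[simp]: "space (wishart V k) = UNIV"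
  by (simp_all add: wishart_def)

lemma transpose_mult_self: "transpose A ** A = (\<Sum>i\<in>UNIV. outer (A $ i))"
  by (simp add: vec_eq_iff matrix_matrix_mult_def transpose_def outer_def)

lemma
  fixes a :: "real^'d" and \<epsilon> L \<sigma> :: real
  assumes \<epsilon>: "0 < \<epsilon>" "\<epsilon> < 1" and \<sigma>: "0 < \<sigma>" and S: "S \<in> sets borel" and a: "norm a \<le> \<sigma>"
    and k: "CARD('d) + 2 * Suc n \<le> k" and n: "5 \<le> \<epsilon> * Suc n" "12 * L \<le> \<epsilon>\<^sup>2 * Suc n"
  defines "W \<equiv> wishart (\<sigma>\<^sup>2 *\<^sub>R mat 1) k"
  shows measure_wishart_le_add_outer:
      "measure W S \<le> exp (\<epsilon> / 2) * measure W {N. N + outer a \<in> S} + exp (- L)"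
    and measure_wishart_add_outer_le:
      "measure W {N. N + outer a \<in> S} \<le> exp (\<epsilon> / 2) * measure W S + exp (- L)"
proof -
  note [measurable] = S
  interpret W: prob_space W unfolding W_def by (rule prob_space_wishart[OF \<sigma>])
  have sW[measurable_cong]: "sets W = sets borel" by (simp add: W_def)
  obtain e where e: "norm e = 1" "outer a = (norm a)\<^sup>2 *\<^sub>R outer e"
  proof (cases "a = 0")
    case True
    \<comment> \<open>For \<open>a = 0\<close> there is no direction, and any unit vector will
      do.\<close>
    have "norm (axis (undefined::'d) (1::real)) = 1" by simp
    from that[OF this] show ?thesis using True outer_scaleR[of 0 0] by simp
  next
    case False
    have "norm (a /\<^sub>R norm a) = 1" using False by simp
    moreover have "outer a = (norm a)\<^sup>2 *\<^sub>R outer (a /\<^sub>R norm a)"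
      unfolding outer_scaleR[symmetric] using False by simp
    ultimately show ?thesis by (rule that)
  qed
  \<comment> \<open>The scale of the Wishart matrix equals the bound on the row norm, so the shift
    is at most half the inverse rate \<open>2 * \<sigma>\<^sup>2\<close>.\<close>
  have l: "0 < 1 / (2 * \<sigma>\<^sup>2)" "0 \<le> (norm a)\<^sup>2" "1 / (2 * \<sigma>\<^sup>2) * (norm a)\<^sup>2 \<le> 1 / 2"
    using \<sigma> power_mono[OF a, of 2] by (simp_all add: field_simps)
  have int: "(\<integral>\<^sup>+N. indicator S (N + t *\<^sub>R outer e) \<partial>W) = ennreal (measure W {N. N + t *\<^sub>R outer e \<in> S})" for t
  proof -
    have "{N. N + t *\<^sub>R outer e \<in> S} \<in> sets W" unfolding sW by measurable
    moreover have "indicator S (N + t *\<^sub>R outer e) = (indicator {N. N + t *\<^sub>R outer e \<in> S} N :: ennreal)" for N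
      by (simp add: indicator_def)
    ultimately show ?thesis by (simp add: W.emeasure_eq_measure)
  qed
  have to_real: "x \<le> exp (\<epsilon> / 2) * y + exp (- L)"
    if "ennreal x \<le> ennreal (exp (\<epsilon> / 2)) * ennreal y + ennreal (exp (- L))" "0 \<le> y" for x y
    using that by (simp add: ennreal_mult[symmetric] ennreal_plus[symmetric] del: ennreal_plus)
  note wish = nn_integral_wishart_shift_le[OF \<sigma> S k e(1), where K="ennreal (exp (\<epsilon> / 2))" and D="ennreal (exp (- L))", folded W_def]
  show "measure W S \<le> exp (\<epsilon> / 2) * measure W {N. N + outer a \<in> S} + exp (- L)"
    using wish[of 0 "(norm a)\<^sup>2", OF erlang_le_shifted[OF \<epsilon> l n]]
    unfolding int by (intro to_real) (simp_all add: e(2))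
  show "measure W {N. N + outer a \<in> S} \<le> exp (\<epsilon> / 2) * measure W S + exp (- L)"
    using wish[of "(norm a)\<^sup>2" 0, OF shifted_erlang_le[OF \<epsilon> l n]]
    unfolding int by (intro to_real) (simp_all add: e(2))
qed

theorem theorem4p1:
  fixes \<epsilon> \<delta> B :: real and k :: nat
  assumes "0 < \<epsilon>" "\<epsilon> < 1"
    and "0 < \<delta>" "\<delta> < 1 / exp 1"
    and "0 < B"
    and "int k \<ge> \<lfloor>real CARD('d) + 14 / \<epsilon>^2 * (2 * ln (4 / \<delta>))\<rfloor>"
  shows "differentially_private \<epsilon> \<delta> B
           (\<lambda>A :: real^'d^'n. distr (wishart ((B^2) *\<^sub>R mat 1) k) borel
                                   (\<lambda>N. transpose A ** A + N))"
proof -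
  define L where "L = ln (4 / \<delta>)"
  have expL: "exp (- L) = \<delta> / 4" using assms by (simp add: L_def exp_minus)
  have "1 \<le> L"
  proof -
    have "exp 1 * \<delta> \<le> 4" using assms by (simp add: field_simps)
    then have "exp 1 \<le> 4 / \<delta>" using assms by (simp add: field_simps)
    then show ?thesis unfolding L_def using assms by (subst ln_ge_iff) auto
  qed
  \<comment> \<open>This is the excess over \<open>CARD('d)\<close> demanded by the hypothesis: 28
    is 14 times 2.\<close>
  define y where "y = 28 * L / \<epsilon>\<^sup>2"
  have "28 \<le> y"
  proof -
    have "28 * \<epsilon>\<^sup>2 \<le> 28 * 1" using assms by (intro mult_left_mono power_le_one) auto
    also have "\<dots> \<le> 28 * L" using \<open>1 \<le> L\<close> by simp
    finally show ?thesis using assms by (simp add: y_def field_simps)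
  qed
  have "\<lfloor>real CARD('d) + y\<rfloor> \<le> int k"
    using assms(6) by (simp add: y_def L_def mult_ac)
  then have "real CARD('d) + y - 1 < real k"
    by linarith
  define p where "p = (k - CARD('d)) div 2"
  have "CARD('d) + 2 * p \<le> k" "k \<le> CARD('d) + 2 * p + 1"
    using \<open>real CARD('d) + y - 1 < real k\<close> \<open>28 \<le> y\<close> unfolding p_def by linarith+
  \<comment> \<open>The floor and the parity of \<open>k - CARD('d)\<close> cost up to one degree of
    freedom each, hence one unit of \<open>p\<close>.\<close>
  then have p: "y / 2 - 1 \<le> real p"
    using \<open>real CARD('d) + y - 1 < real k\<close> by linarith
  then have "0 < p" using \<open>28 \<le> y\<close> by auto
  then obtain n where n: "p = Suc n" by (metis Suc_pred)
  have k: "CARD('d) + 2 * Suc n \<le> k" using \<open>CARD('d) + 2 * p \<le> k\<close> n by simp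
  have n2: "12 * L \<le> \<epsilon>\<^sup>2 * Suc n"
  proof -
    have "\<epsilon>\<^sup>2 \<le> 1" using assms by (intro power_le_one) auto
    \<comment> \<open>Half of \<open>y\<close> contributes \<open>14 * L\<close>. The unit lost
      above costs \<open>\<epsilon>\<^sup>2\<close>, at most 1 and thus at most
      \<open>2 * L\<close>, leaving the required \<open>12 * L\<close>.\<close>
    then have "12 * L \<le> 14 * L - \<epsilon>\<^sup>2" using \<open>1 \<le> L\<close> by linarith
    also have "\<dots> = \<epsilon>\<^sup>2 * (y / 2 - 1)" using assms by (simp add: y_def field_simps)
    also have "\<dots> \<le> \<epsilon>\<^sup>2 * p" using p by (intro mult_left_mono) auto
    finally show ?thesis using n by simp
  qed
  have n1: "5 \<le> \<epsilon> * Suc n"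
  proof -
    have "5 \<le> \<epsilon>\<^sup>2 * Suc n" using n2 \<open>1 \<le> L\<close> by linarith
    also have "\<dots> \<le> \<epsilon> * Suc n"
      using assms by (intro mult_right_mono) (auto simp: power2_eq_square mult_le_one)
    finally show ?thesis .
  qed
  let ?W = "wishart ((B^2) *\<^sub>R mat 1 :: real^'d^'d) k"
  show ?thesis
    unfolding differentially_private_def
  proof (intro allI impI ballI)
    fix A A' :: "real^'d^'n" and S :: "(real^'d^'d) set"
    assume AA': "rows_bounded B A \<and> rows_bounded B A' \<and> neighbors A A'" and S[measurable]: "S \<in> sets borel"
    then obtain i0 where i0: "{i. A $ i \<noteq> A' $ i} = {i0}"
      unfolding neighbors_def by (meson card_1_singletonE)
    define C where "C = (\<Sum>i\<in>UNIV - {i0}. outer (A $ i))"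
    have A: "transpose A ** A = C + outer (A $ i0)"
      unfolding transpose_mult_self C_def by (subst sum.remove[of _ i0]) (auto simp: add.commute)
    have "C = (\<Sum>i\<in>UNIV - {i0}. outer (A' $ i))"
    proof -
      have "A $ i = A' $ i" if "i \<noteq> i0" for i using i0 that by blast
      then show ?thesis unfolding C_def by (intro sum.cong) auto
    qed
    then have A': "transpose A' ** A' = C + outer (A' $ i0)"
      unfolding transpose_mult_self by (subst sum.remove[of _ i0]) (auto simp: add.commute)
    \<comment> \<open>The Gram matrix \<open>C\<close> of the common rows is absorbed into the
      event, leaving one rank-one term on either side.\<close>
    define S' where "S' = {Y. C + Y \<in> S}"
    have S': "S' \<in> sets borel" unfolding S'_def by measurable
    have distr: "measure (distr ?W borel (\<lambda>N. (C + outer a) + N)) S = measure ?W {N. N + outer a \<in> S'}" for a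
      by (subst measure_distr) (auto simp: S'_def vimage_def add_ac)
    have "norm (A $ i0) \<le> B" "norm (A' $ i0) \<le> B"
      using AA' by (auto simp: rows_bounded_def)
    note le = measure_wishart_add_outer_le[OF assms(1,2,5) S' this(1) k n1 n2]
      measure_wishart_le_add_outer[OF assms(1,2,5) S' this(2) k n1 n2]
    have "measure ?W {N. N + outer (A $ i0) \<in> S'} \<le> exp (\<epsilon> / 2) * measure ?W S' + \<delta> / 4"
      using le(1) expL by simp
    \<comment> \<open>The intermediate step is \<open>N\<close> without any rank-one term: the row
      of \<open>A\<close> is removed first, then that of \<open>A'\<close> is added.\<close>
    also have "\<dots> \<le> exp (\<epsilon> / 2) * (exp (\<epsilon> / 2) * measure ?W {N. N + outer (A' $ i0) \<in> S'} + \<delta> / 4) + \<delta> / 4"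
      using le(2) expL by (intro add_right_mono mult_left_mono) auto
    also have "\<dots> = exp \<epsilon> * measure ?W {N. N + outer (A' $ i0) \<in> S'} + (exp (\<epsilon> / 2) + 1) * (\<delta> / 4)"
      using exp_add[of "\<epsilon> / 2" "\<epsilon> / 2"] by (simp add: algebra_simps)
    \<comment> \<open>The error of the second comparison is multiplied by
      \<open>exp (\<epsilon> / 2)\<close>, which is below 3; together with the first error this
      makes at most four quarters of \<open>\<delta>\<close>.\<close>
    also have "(exp (\<epsilon> / 2) + 1) * (\<delta> / 4) \<le> 4 * (\<delta> / 4)"
    proof (rule mult_right_mono)
      have "exp (\<epsilon> / 2) \<le> exp 1" using assms by simp
      then show "exp (\<epsilon> / 2) + 1 \<le> 4" using exp_le by linarith
    qed (use assms in simp)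
    finally show "measure (distr ?W borel (\<lambda>N. transpose A ** A + N)) S
      \<le> exp \<epsilon> * measure (distr ?W borel (\<lambda>N. transpose A' ** A' + N)) S + \<delta>"
      unfolding A A' distr by simp
  qed
qed

end
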